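(* Let $k/\mathbb{Q}$ be a finite extension with ring of integers $\mathcal{O}_k$. Let $H\in\mathcal{O}_k[Y,X_1]$ be irreducible over $k(X_1)$, monic in $Y$, and of total degree $D$. Define $\mathcal{L}_H=k(X_1)[Y]/(H(Y,X_1))$. The following are equivalent: (I) $H$ is a $1$-genuine polynomial, that is to say, $k(X_1)[Y]/(H(Y,X_1))$ is a $1$-genuine extension of $k(X_1)$. (II) $(\overline{k}\cap\mathcal{L}_H)(X_1)\subsetneq\mathcal{L}_H$. (III) $H(Y,X_1)$ does not have a linear factor in $Y$ over $\overline{\mathbb{Q}}$. (IV) Expanding $H(Y,X_1)=\sum_{\ell+m\le D}a_{\ell,m}Y^\ell X_1^m$, the form $B_{\mathrm{lin}}$ evaluated at the coefficients, $B_{\mathrm{lin}}((a_{\ell,m})_{\ell,m})$, is nonzero.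
   Context: A finite (nontrivial) extension $M$ of $k(X_1)$ is a $1$-genuine extension if every $G(Y,X_1)\in k[Y,X_1]$ with $M=k(X_1)[Y]/(G)$ has nonzero degree in $X_1$. A polynomial in $k[Y,X_1]$ monic in $Y$ and irreducible over $k(X_1)$ is $1$-genuine if the extension of $k(X_1)$ it defines is $1$-genuine. $\overline{k}\cap\mathcal{L}_H$ is the set of elements of $\mathcal{L}_H$ algebraic over $k$, and $(\overline{k}\cap\mathcal{L}_H)(X_1)$ the subfield of $\mathcal{L}_H$ generated by it and $X_1$. A polynomial $f(Y,Z)$ has a linear factor in $Y$ over $\overline{\mathbb{Q}}$ if $f(Y,Z)=(Y-Q(Z))\tilde H(Y,Z)$ with $Q\in\overline{\mathbb{Q}}[Z]$, $\tilde H\in\overline{\mathbb{Q}}[Y,Z]$. $B_{\mathrm{lin}}$: for the given $D$, a finite collection of forms (homogeneous polynomials) with integer coefficients in variables $(A_{\ell,m})_{\ell+m\le D}$, depending only on $D$ (treated as a single form), such that for every $f(Y,Z)=\sum_{\ell+m\le D}a_{\ell,m}Y^\ell Z^m$ with coefficients in $k$ that is monic in $Y$, all the forms vanish at $(a_{\ell,m})$ if and only if $f$ has a linear factor in $Y$ over $\overline{\mathbb{Q}}$ or $\deg f<D$. "$B_{\mathrm{lin}}((a_{\ell,m}))$ is nonzero" means that not all of the forms vanish at $(a_{\ell,m})$. *)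

theory Defs
  imports
    "HOL-Algebra.Algebra"
    "HOL-Algebra.Algebraic_Closure_Type"
    "HOL-Computational_Algebra.Computational_Algebra"
    "HOL-Library.Poly_Mapping"
begin

text \<open>
  A number field is a type \<open>'k\<close> of characteristic 0 that is finite-dimensional over the
  rationals. A polynomial in \<open>k[Y, X\<^sub>1]\<close> is an element of \<open>'k poly poly\<close>: the outer variable is
  \<open>Y\<close> and the inner one is \<open>X\<^sub>1\<close> (or \<open>Z\<close>), so the coefficient of \<open>Y ^ l * X\<^sub>1 ^ m\<close> is
  \<open>coeff (coeff f l) m\<close>. The field \<open>k(X\<^sub>1)\<close> is \<open>'k poly fract\<close>. Many names below are qualified
  because HOL-Algebra uses the same names for its list-based polynomials.
\<close>

definition number_field :: "'k::field_char_0 itself \<Rightarrow> bool" where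
  "number_field _ \<longleftrightarrow>
     (\<exists>S::'k set. finite S \<and> module.span (\<lambda>(q::rat) x. of_rat q * x) S = UNIV)"

definition bicoeff :: "'a::zero poly poly \<Rightarrow> nat \<times> nat \<Rightarrow> 'a" where
  "bicoeff f = (\<lambda>(l, m). Polynomial.coeff (Polynomial.coeff f l) m)"

text \<open>The zero polynomial gets total degree 0 and degree 0 in \<open>X\<^sub>1\<close>.\<close>

definition total_degree :: "'a::zero poly poly \<Rightarrow> nat" where
  "total_degree f = Max (insert 0 {l + m | l m. bicoeff f (l, m) \<noteq> 0})"

definition degree_X1 :: "'a::zero poly poly \<Rightarrow> nat" where
  "degree_X1 f = Max (insert 0 {m | l m. bicoeff f (l, m) \<noteq> 0})"

definition monic_in_Y :: "'a::comm_semiring_1 poly poly \<Rightarrow> bool" where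
  "monic_in_Y f \<longleftrightarrow> Polynomial.lead_coeff f = 1"

definition over_rat_fun :: "'k::field poly poly \<Rightarrow> 'k poly fract poly" where
  "over_rat_fun G = map_poly to_fract G"

definition irreducible_over_rat_fun :: "'k::field poly poly \<Rightarrow> bool" where
  "irreducible_over_rat_fun G \<longleftrightarrow> Factorial_Ring.irreducible (over_rat_fun G)"


text \<open>\<open>k(X\<^sub>1)[Y]/(G)\<close> together with its structure map from \<open>k(X\<^sub>1)\<close>\<close>

definition rat_fun_poly_ring :: "'k::field poly fract poly ring" where
  "rat_fun_poly_ring = ring_of_type_algebra"

definition ext_ring :: "'k::field poly poly \<Rightarrow> 'k poly fract poly set ring" where
  "ext_ring G = rat_fun_poly_ring Quot (PIdl\<^bsub>rat_fun_poly_ring\<^esub> (over_rat_fun G))"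

definition ext_emb :: "'k::field poly poly \<Rightarrow> 'k poly fract \<Rightarrow> 'k poly fract poly set" where
  "ext_emb G c = (PIdl\<^bsub>rat_fun_poly_ring\<^esub> (over_rat_fun G)) +>\<^bsub>rat_fun_poly_ring\<^esub> [:c:]"


text \<open>
  An extension of \<open>k(X\<^sub>1)\<close> is a field \<open>M\<close> with a ring homomorphism \<open>\<phi>\<close> from \<open>k(X\<^sub>1)\<close>, and
  the equality \<open>M = k(X\<^sub>1)[Y]/(G)\<close> means isomorphism of extensions of \<open>k(X\<^sub>1)\<close>.
\<close>

definition finite_nontrivial_extension ::
    "('a, 'b) ring_scheme \<Rightarrow> ('k::field poly fract \<Rightarrow> 'a) \<Rightarrow> bool" where
  "finite_nontrivial_extension M \<phi> \<longleftrightarrow>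
     field M \<and> \<phi> \<in> ring_hom ring_of_type_algebra M \<and>
     ring.finite_dimension M (range \<phi>) (carrier M) \<and> range \<phi> \<noteq> carrier M"

definition defined_by ::
    "('a, 'b) ring_scheme \<Rightarrow> ('k::field poly fract \<Rightarrow> 'a) \<Rightarrow> 'k poly poly \<Rightarrow> bool" where
  "defined_by M \<phi> G \<longleftrightarrow> (\<exists>h \<in> ring_iso (ext_ring G) M. \<forall>c. h (ext_emb G c) = \<phi> c)"

definition one_genuine_extension ::
    "('a, 'b) ring_scheme \<Rightarrow> ('k::field poly fract \<Rightarrow> 'a) \<Rightarrow> bool" where
  "one_genuine_extension M \<phi> \<longleftrightarrow>
     finite_nontrivial_extension M \<phi> \<and> (\<forall>G. defined_by M \<phi> G \<longrightarrow> degree_X1 G \<noteq> 0)"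

definition one_genuine_poly :: "'k::field poly poly \<Rightarrow> bool" where
  "one_genuine_poly G \<longleftrightarrow>
     monic_in_Y G \<and> irreducible_over_rat_fun G \<and>
     one_genuine_extension (ext_ring G) (ext_emb G)"


definition ext_consts :: "'k::field poly poly \<Rightarrow> 'k poly fract poly set set" where
  "ext_consts G = range (\<lambda>c. ext_emb G (to_fract [:c:]))"

definition ext_X1 :: "'k::field poly poly \<Rightarrow> 'k poly fract poly set" where
  "ext_X1 G = ext_emb G (to_fract [:0, 1:])"

definition ext_algebraic :: "'k::field poly poly \<Rightarrow> 'k poly fract poly set set" where
  "ext_algebraic G = {x \<in> carrier (ext_ring G). ring.algebraic (ext_ring G) (ext_consts G) x}"

definition ext_algebraic_X1 :: "'k::field poly poly \<Rightarrow> 'k poly fract poly set set" where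
  "ext_algebraic_X1 G = generate_field (ext_ring G) (insert (ext_X1 G) (ext_algebraic G))"


text \<open>
  An algebraic closure of a number field \<open>k\<close> is also one of the rationals; it is taken to be
  the type \<open>'k alg_closure\<close>, with \<open>to_ac\<close> the inclusion of \<open>k\<close>. The factor \<open>[:- Q, 1:]\<close> is
  \<open>Y - Q(Z)\<close>.
\<close>

definition has_linear_factor_Y :: "'k::field poly poly \<Rightarrow> bool" where
  "has_linear_factor_Y f \<longleftrightarrow>
     (\<exists>(Q :: 'k alg_closure poly) (H' :: 'k alg_closure poly poly).
        map_poly (map_poly to_ac) f = [:- Q, 1:] * H')"


text \<open>
  Polynomials with integer coefficients in the variables \<open>A\<^bsub>l,m\<^esub>\<close>, as finitely supported maps
  from monomials, themselves finitely supported maps from variables to exponents.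
\<close>

type_synonym int_mpoly = "((nat \<times> nat) \<Rightarrow>\<^sub>0 nat) \<Rightarrow>\<^sub>0 int"

definition eval_int_mpoly :: "int_mpoly \<Rightarrow> (nat \<times> nat \<Rightarrow> 'a::comm_ring_1) \<Rightarrow> 'a" where
  "eval_int_mpoly F a =
     (\<Sum>e \<in> Poly_Mapping.keys F. of_int (Poly_Mapping.lookup F e) *
        (\<Prod>v \<in> Poly_Mapping.keys e. a v ^ Poly_Mapping.lookup e v))"

definition is_form :: "nat \<Rightarrow> int_mpoly \<Rightarrow> bool" where
  "is_form D F \<longleftrightarrow>
     (\<forall>e \<in> Poly_Mapping.keys F. Poly_Mapping.keys e \<subseteq> {(l, m). l + m \<le> D}) \<and>
     (\<exists>d. \<forall>e \<in> Poly_Mapping.keys F. (\<Sum>v \<in> Poly_Mapping.keys e. Poly_Mapping.lookup e v) = d)"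

text \<open>
  \<open>B\<close> is a collection \<open>B\<^sub>l\<^sub>i\<^sub>n\<close> for the degree bound \<open>D\<close>. The property is only required over
  the number field \<open>'k\<close> at hand; a collection depending on \<open>D\<close> alone has it over every one.
\<close>

definition is_B_lin :: "'k::field_char_0 itself \<Rightarrow> nat \<Rightarrow> int_mpoly set \<Rightarrow> bool" where
  "is_B_lin _ D B \<longleftrightarrow>
     finite B \<and> (\<forall>F \<in> B. is_form D F) \<and>
     (\<forall>f :: 'k poly poly. total_degree f \<le> D \<and> monic_in_Y f \<longrightarrow>
        ((\<forall>F \<in> B. eval_int_mpoly F (bicoeff f) = 0) \<longleftrightarrow>
         has_linear_factor_Y f \<or> total_degree f < D))"

definition B_nonzero_at :: "int_mpoly set \<Rightarrow> (nat \<times> nat \<Rightarrow> 'a::comm_ring_1) \<Rightarrow> bool" where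
  "B_nonzero_at B a \<longleftrightarrow> (\<exists>F \<in> B. eval_int_mpoly F a \<noteq> 0)"

end

theory Submission
  imports Defs
begin

text \<open>
  Conditions (III) and (IV) are equivalent by the defining property of \<open>B\<close>, because \<open>H\<close> has total
  degree exactly \<open>D\<close>. The other equivalences are proved as a cycle between the negations.

  A linear factor gives a defining polynomial with constant coefficients
  (\<open>linear_factor_imp_defined_by_const\<close>). Let \<open>Q\<close> be a polynomial in \<open>X\<close> over the algebraic closure
  of \<open>k\<close> that is a root of \<open>H\<close>. For all but finitely many \<open>c\<close> in \<open>k\<close>, the value \<open>\<alpha> = Q(c)\<close> is a
  simple root of \<open>H(Y, c)\<close> by separability, and Newton approximation at \<open>c\<close> recovers \<open>Q\<close> from \<open>\<alpha>\<close> with all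
  operations in \<open>k(\<alpha>)[X]\<close> (\<open>root_in_simple_extension\<close>). So \<open>Q\<close>, of degree \<open>deg H\<close> over \<open>k(X)\<close>, lies in
  the extension generated by \<open>\<alpha>\<close>, of degree at most \<open>deg H\<close>; the two extensions coincide
  (\<open>generator_exchange\<close>) and \<open>H(Y, c)\<close>, which has degree 0 in \<open>X\<close>, defines the same extension as \<open>H\<close>.
  This takes the place of Galois descent and of the primitive element theorem.

  A defining polynomial with constant coefficients makes the class of its variable algebraic over
  \<open>k\<close>, and this class generates the extension over \<open>k(X)\<close> (\<open>defined_by_const_imp_generated\<close>). An
  extension that is not proper is generated by \<open>X\<close> and constants (\<open>ext_emb_in_ext_algebraic_X1\<close>), so
  it belongs to this case.

  If algebraic elements and \<open>X\<close> generate the extension, then every root of \<open>H\<close> in an algebraic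
  closure of the rational function field over the algebraic closure of \<open>k\<close> is already a rational
  function, hence a polynomial since \<open>H\<close> is monic (\<open>generated_imp_linear_factor\<close>).
\<close>

hide_const (open) Polynomials.degree Polynomials.lead_coeff

section \<open>Embeddings of domains and roots of polynomials\<close>

locale domain_embedding =
  fixes h :: "'a::idom \<Rightarrow> 'b::idom"
  assumes one [simp]: "h 1 = 1"
    and add [simp]: "h (a + b) = h a + h b"
    and mult [simp]: "h (a * b) = h a * h b"
    and eq_0_imp: "h a = 0 \<Longrightarrow> a = 0"
begin

lemma zero [simp]: "h 0 = 0"
  using add[of 0 0] by (metis add_0_right add_left_cancel)

lemma eq_0_iff [simp]: "h a = 0 \<longleftrightarrow> a = 0"
  using eq_0_imp by auto

lemma uminus [simp]: "h (- a) = - h a"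
  using add[of "- a" a] by (simp add: eq_neg_iff_add_eq_0)

lemma diff [simp]: "h (a - b) = h a - h b"
  using add[of a "- b"] by simp

lemma map_poly_pCons [simp]: "map_poly h (pCons a p) = pCons (h a) (map_poly h p)"
  by (simp add: Polynomial.map_poly_pCons)

lemma degree_map_poly [simp]: "degree (map_poly h p) = degree p"
  by (rule Polynomial.degree_map_poly) auto

lemma coeff_map_poly [simp]: "poly.coeff (map_poly h p) n = h (poly.coeff p n)"
  by (simp add: Polynomial.coeff_map_poly)

lemma map_poly_add [simp]: "map_poly h (p + q) = map_poly h p + map_poly h q"
  by (rule poly_eqI) simp

lemma map_poly_smult [simp]: "map_poly h (smult a p) = smult (h a) (map_poly h p)"
  by (rule poly_eqI) simp

lemma map_poly_mult [simp]: "map_poly h (p * q) = map_poly h p * map_poly h q"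
  by (induction p) simp_all

lemma map_poly_embedding: "domain_embedding (map_poly h)"
  by unfold_locales (auto simp: map_poly_eq_0_iff poly_eq_iff)

lemma map_poly_uminus [simp]: "map_poly h (- p) = - map_poly h p"
  by (rule poly_eqI) simp

lemma map_poly_diff [simp]: "map_poly h (p - q) = map_poly h p - map_poly h q"
  by (rule poly_eqI) simp

lemma map_poly_pderiv: "map_poly h (pderiv p) = pderiv (map_poly h p)"
  by (induction p) (simp_all add: pderiv_pCons)

lemma map_poly_pcompose: "map_poly h (pcompose p q) = pcompose (map_poly h p) (map_poly h q)"
  by (induction p) (simp_all add: pcompose_pCons)

lemma poly_map_poly [simp]: "poly (map_poly h p) (h x) = h (poly p x)"
  by (induction p) simp_all

end

lemma map_poly_comp:
  assumes "domain_embedding f" "domain_embedding g"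
  shows "map_poly f (map_poly g p) = map_poly (\<lambda>x. f (g x)) p"
proof -
  interpret f: domain_embedding f by fact
  interpret g: domain_embedding g by fact
  show ?thesis by (simp add: map_poly_map_poly comp_def)
qed

lemma comp_embedding:
  assumes "domain_embedding f" "domain_embedding g"
  shows "domain_embedding (\<lambda>x. f (g x))"
proof -
  interpret f: domain_embedding f by fact
  interpret g: domain_embedding g by fact
  show ?thesis by unfold_locales auto
qed

lemma to_ac_embedding: "domain_embedding to_ac"
  by unfold_locales auto

lemma to_fract_embedding: "domain_embedding to_fract"
  by unfold_locales auto

lemma const_embedding: "domain_embedding (\<lambda>c::'a::idom. [:c:])"
  by unfold_locales (auto simp: one_pCons)

text \<open>
  The choice of a representation of \<open>x\<close> as a fraction avoids normalized fractions, which would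
  need greatest common divisors in the domain.
\<close>

definition map_fract :: "('a::idom \<Rightarrow> 'b::idom) \<Rightarrow> 'a fract \<Rightarrow> 'b fract" where
  "map_fract f x = (SOME y. \<exists>a b. b \<noteq> 0 \<and> x = Fract a b \<and> y = Fract (f a) (f b))"

context domain_embedding
begin

lemma map_fract_Fract:
  assumes "b \<noteq> 0"
  shows "map_fract h (Fract a b) = Fract (h a) (h b)"
  unfolding map_fract_def
proof (rule some_equality)
  show "\<exists>a' b'. b' \<noteq> 0 \<and> Fract a b = Fract a' b' \<and> Fract (h a) (h b) = Fract (h a') (h b')"
    using assms by blast
next
  fix y assume "\<exists>a' b'. b' \<noteq> 0 \<and> Fract a b = Fract a' b' \<and> y = Fract (h a') (h b')"
  then obtain a' b' where *: "b' \<noteq> 0" "a * b' = a' * b" "y = Fract (h a') (h b')"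
    using assms by (auto simp: eq_fract)
  then have "h a * h b' = h a' * h b"
    by (metis mult)
  then show "y = Fract (h a) (h b)"
    using * assms by (simp add: eq_fract)
qed

lemma map_fract_to_fract [simp]: "map_fract h (to_fract a) = to_fract (h a)"
  by (simp add: to_fract_def map_fract_Fract)

lemma map_fract_embedding: "domain_embedding (map_fract h)"
proof
  show "map_fract h 1 = 1"
    by (simp add: One_fract_def map_fract_Fract)
  show "map_fract h (x + y) = map_fract h x + map_fract h y" for x y
    by (cases x; cases y) (simp add: map_fract_Fract)
  show "map_fract h (x * y) = map_fract h x * map_fract h y" for x y
    by (cases x; cases y) (simp add: map_fract_Fract)
  show "x = 0" if "map_fract h x = 0" for x
    using that by (cases x) (auto simp: map_fract_Fract Zero_fract_def eq_fract)
qed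

end

text \<open>
  A nonzero element of least degree in the ideal \<open>(p, q)\<close> divides both \<open>p\<close> and \<open>q\<close>; as the irreducible
  \<open>p\<close> does not divide \<open>q\<close>, it is a unit.
\<close>

lemma irreducible_bezout:
  fixes p q :: "'a::field poly"
  assumes p: "Factorial_Ring.irreducible p" and "\<not> p dvd q"
  shows "\<exists>u v. u * p + v * q = 1"
proof -
  define J where "J = {u * p + v * q | u v. True}"
  have J_diff: "x - y * z \<in> J" if "x \<in> J" "z \<in> J" for x y z
  proof -
    obtain u v u' v' where "x = u * p + v * q" "z = u' * p + v' * q"
      using \<open>x \<in> J\<close> \<open>z \<in> J\<close> by (auto simp: J_def)
    then have "x - y * z = (u - y * u') * p + (v - y * v') * q"
      by (simp add: algebra_simps)
    then show ?thesis by (auto simp: J_def)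
  qed
  have "p = 1 * p + 0 * q" "q = 0 * p + 1 * q" by simp_all
  then have pq: "p \<in> J" "q \<in> J" unfolding J_def by blast+
  have "p \<noteq> 0" using p by auto
  define d where "d = (ARG_MIN degree x. x \<in> J \<and> x \<noteq> 0)"
  have d: "d \<in> J" "d \<noteq> 0" and min: "\<And>x. x \<in> J \<Longrightarrow> x \<noteq> 0 \<Longrightarrow> degree d \<le> degree x"
    unfolding d_def using arg_min_nat_lemma[of "\<lambda>x. x \<in> J \<and> x \<noteq> 0" p degree] pq \<open>p \<noteq> 0\<close>
    by auto
  have dvd: "d dvd x" if "x \<in> J" for x
  proof -
    have "x mod d = x - (x div d) * d" by (simp add: minus_div_mult_eq_mod)
    then have "x mod d \<in> J" using J_diff that d by simp
    then have "x mod d = 0"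
      using min[of "x mod d"] degree_mod_less[OF d(2), of x] by fastforce
    then show ?thesis by auto
  qed
  from dvd[OF pq(1)] obtain e where e: "p = d * e" by (auto elim: dvdE)
  have "is_unit d"
  proof (rule ccontr)
    assume "\<not> is_unit d"
    then have "is_unit e" using Factorial_Ring.irreducibleD[OF p e] by blast
    then have "p dvd d" using e by (metis dvd_triv_right mult_dvd_mono mult_unit_dvd_iff one_dvd dvd_refl)
    then show False using dvd[OF pq(2)] assms(2) dvd_trans by blast
  qed
  then obtain f where f: "f * d = 1" by (metis dvdE mult.commute)
  obtain u v where "d = u * p + v * q" using d by (auto simp: J_def)
  then have "(f * u) * p + (f * v) * q = 1" using f by (simp add: algebra_simps)
  then show ?thesis by blast
qed

text \<open>
  The kernel of evaluation at a root of an irreducible \<open>p\<close> is a proper ideal containing \<open>p\<close>;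
  by Bezout it is exactly the ideal of \<open>p\<close>.
\<close>

lemma root_iff_irreducible_dvd:
  fixes p q :: "'a::field poly" and h :: "'a \<Rightarrow> 'b::idom"
  assumes p: "Factorial_Ring.irreducible p" and "domain_embedding h"
    and root: "poly (map_poly h p) x = 0"
  shows "poly (map_poly h q) x = 0 \<longleftrightarrow> p dvd q"
proof
  interpret domain_embedding h by fact
  assume q: "poly (map_poly h q) x = 0"
  show "p dvd q"
  proof (rule ccontr)
    assume "\<not> p dvd q"
    then obtain u v where "u * p + v * q = 1" using irreducible_bezout[OF p] by blast
    then have "poly (map_poly h (u * p + v * q)) x = 1" by simp
    then show False using root q by simp
  qed
next
  interpret domain_embedding h by fact
  assume "p dvd q"
  then show "poly (map_poly h q) x = 0" using root by (auto elim!: dvdE)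
qed

text \<open>
  The Taylor expansion of order two, in the division-free form that the Newton step needs.
\<close>

lemma poly_taylor2: "\<exists>w. poly f (x + d) = poly f x + poly (pderiv f) x * d + d * d * w"
  for f :: "'a::idom poly"
proof (induction f)
  case (pCons a f)
  then obtain w where w: "poly f (x + d) = poly f x + poly (pderiv f) x * d + d * d * w"
    by blast
  have "poly (pCons a f) (x + d) = poly (pCons a f) x + poly (pderiv (pCons a f)) x * d
      + d * d * (x * w + poly (pderiv f) x + d * w)"
    unfolding poly_pCons pderiv_pCons poly_add w by (simp add: algebra_simps)
  then show ?case by blast
qed auto

lemma poly_poly_eval: "poly (poly f t) c = poly (map_poly (\<lambda>p. poly p c) f) (poly t c)"
  for f :: "'a::idom poly poly"
  by (induction f) (simp_all add: Polynomial.map_poly_pCons)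

text \<open>
  If \<open>a + X * p\<close> vanishes at \<open>x\<close> with \<open>a\<close> a nonzero constant, then \<open>x * p(x) = - a\<close>, which exhibits
  the inverse of \<open>x\<close>; a zero constant term can be divided out.
\<close>

lemma inverse_of_root:
  fixes p :: "'a::field poly" and h :: "'a \<Rightarrow> 'b::field"
  assumes "domain_embedding h"
    and "p \<noteq> 0" "poly (map_poly h p) x = 0" "x \<noteq> 0"
  shows "\<exists>u. inverse x = poly (map_poly h u) x"
  using assms(2,3)
proof (induction p)
  interpret domain_embedding h by fact
  case (pCons a p)
  show ?case
  proof (cases "a = 0")
    case True
    then show ?thesis using pCons assms by auto
  next
    case False
    have "x * poly (map_poly h p) x = - h a"
      using pCons by (simp add: eq_neg_iff_add_eq_0 add.commute)
    moreover have "h (inverse a) * h a = 1"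
      using False by (metis mult one left_inverse)
    moreover have "x * poly (map_poly h (smult (- inverse a) p)) x
        = - h (inverse a) * (x * poly (map_poly h p) x)"
      by simp
    ultimately have "x * poly (map_poly h (smult (- inverse a) p)) x = 1"
      by simp
    then have "inverse x = poly (map_poly h (smult (- inverse a) p)) x"
      by (rule inverse_unique)
    then show ?thesis by blast
  qed
qed auto

section \<open>Newton approximation of a polynomial root\<close>

text \<open>
  A step of the simplified Newton iteration in the \<open>(X - c)\<close>-adic topology. The derivative is
  inverted only at the point \<open>(Q(c), c)\<close> and not at the approximation \<open>T\<close>, so that the next
  approximation is obtained from \<open>T\<close> by ring operations and one fixed constant; the price is that
  the precision grows by one instead of doubling.
\<close>

lemma newton_step:
  fixes f :: "'a::field poly poly" and Q T :: "'a poly"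
  assumes root: "poly f Q = 0" and "0 < n"
    and dvd: "[:- c, 1:] ^ n dvd Q - T"
    and simple: "poly (poly (pderiv f) Q) c \<noteq> 0"
  shows "[:- c, 1:] ^ Suc n dvd Q - (T - smult (inverse (poly (poly (pderiv f) Q) c)) (poly f T))"
proof -
  define d where "d = Q - T"
  define u where "u = inverse (poly (poly (pderiv f) Q) c)"
  have "[:- c, 1:] dvd d"
    using dvd_trans[OF dvd_power[of n "[:- c, 1:]"] dvd] \<open>0 < n\<close> by (simp add: d_def)
  then have "poly d c = 0" by (simp add: poly_eq_0_iff_dvd)
  then have "poly T c = poly Q c" by (simp add: d_def)
  then have "poly (1 - smult u (poly (pderiv f) T)) c = 0"
    using simple by (simp add: u_def poly_poly_eval[of _ T] poly_poly_eval[of _ Q])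
  then have unit: "[:- c, 1:] dvd 1 - smult u (poly (pderiv f) T)"
    by (simp only: poly_eq_0_iff_dvd)
  obtain w where "poly f (T + d) = poly f T + poly (pderiv f) T * d + d * d * w"
    using poly_taylor2 by blast
  then have fT: "poly f T = - (poly (pderiv f) T * d) - d * d * w"
    using root by (simp add: d_def add_eq_0_iff)
  have "Q - (T - smult u (poly f T)) = d + smult u (poly f T)"
    by (simp add: d_def)
  also have "\<dots> = d * (1 - smult u (poly (pderiv f) T)) - d * (d * smult u w)"
    unfolding fT by (simp add: smult_diff_right algebra_simps)
  finally have "Q - (T - smult u (poly f T))
      = d * (1 - smult u (poly (pderiv f) T)) - d * (d * smult u w)" .
  moreover have "[:- c, 1:] ^ n * [:- c, 1:] dvd d * (1 - smult u (poly (pderiv f) T))"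
    using dvd unit by (intro mult_dvd_mono) (simp_all add: d_def)
  moreover have "[:- c, 1:] ^ n * [:- c, 1:] dvd d * (d * smult u w)"
    using dvd \<open>[:- c, 1:] dvd d\<close> by (intro mult_dvd_mono dvd_mult2) (simp_all add: d_def)
  ultimately show ?thesis
    unfolding u_def by (simp add: dvd_diff mult.commute)
qed

lemma poly_degree_bound:
  assumes "\<And>i. degree (poly.coeff f i) < n"
  shows "degree (poly f [:a:]) < n"
  using assms
proof (induction f)
  case (pCons p f)
  have f: "degree (poly.coeff f i) < n" for i using pCons(3)[of "Suc i"] by simp
  have "degree (p + [:a:] * poly f [:a:]) < n"
    using pCons(3)[of 0] pCons.IH[OF f] le_less_trans[OF degree_smult_le]
    by (intro degree_add_less) simp_all
  then show ?case by simp
qed (use assms[of 0] in simp)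

text \<open>
  Hensel's lemma says that a simple root \<open>Q\<close> is determined by its value \<open>\<alpha> = Q(c)\<close>, and Newton
  approximation builds it from \<open>\<alpha>\<close> by operations that stay inside \<open>k(\<alpha>)[X]\<close>. As \<open>Q\<close> is a polynomial,
  an approximation modulo a power of \<open>X - c\<close> that exceeds its degree recovers it. Hence all the
  coefficients of \<open>Q\<close> lie in \<open>k(\<alpha>)\<close>: the value at a good point is a primitive element of the field
  that they generate.
\<close>

lemma root_in_simple_extension:
  fixes h :: "'a::field \<Rightarrow> 'b::field" and f :: "'a poly poly"
  assumes h: "domain_embedding h"
    and alg: "\<And>x. \<exists>p. p \<noteq> 0 \<and> poly (map_poly h p) x = 0"
    and root: "poly (map_poly (map_poly h) f) Q = 0"
    and simple: "poly (poly (pderiv (map_poly (map_poly h) f)) Q) (h c) \<noteq> 0"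
  shows "\<exists>P. Q = poly (map_poly (map_poly h) P) [:poly Q (h c):]"
proof -
  interpret h: domain_embedding h by fact
  interpret hp: domain_embedding "map_poly h" by (rule h.map_poly_embedding)
  interpret const: domain_embedding "\<lambda>x::'a. [:x:]" by (rule const_embedding)
  define \<alpha> where "\<alpha> = poly Q (h c)"
  define ev where "ev = (\<lambda>P. poly (map_poly (map_poly h) P) [:\<alpha>:])"
  define v where "v = poly (poly (pderiv (map_poly (map_poly h) f)) Q) (h c)"
  have "\<exists>U. inverse v = poly (map_poly h U) \<alpha>"
  proof -
    obtain U where "inverse v = poly (map_poly h U) v"
      using alg[of v] inverse_of_root[OF h, of _ v] simple unfolding v_def by blast
    moreover have "v = poly (map_poly h (map_poly (\<lambda>p. poly p c) (pderiv f))) \<alpha>"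
    proof -
      have "map_poly (\<lambda>p. poly p (h c)) (map_poly (map_poly h) (pderiv f))
          = map_poly h (map_poly (\<lambda>p. poly p c) (pderiv f))"
        by (rule poly_eqI) (simp add: Polynomial.coeff_map_poly)
      then show ?thesis
        by (simp add: v_def poly_poly_eval[of _ Q] \<alpha>_def hp.map_poly_pderiv[symmetric])
    qed
    ultimately have "inverse v
        = poly (map_poly h (pcompose U (map_poly (\<lambda>p. poly p c) (pderiv f)))) \<alpha>"
      by (simp add: h.map_poly_pcompose poly_pcompose)
    then show ?thesis by blast
  qed
  then obtain U where U: "inverse v = poly (map_poly h U) \<alpha>" by blast
  have ev_const: "ev (map_poly (\<lambda>x. [:x:]) p) = [:poly (map_poly h p) \<alpha>:]" for p
    unfolding ev_def by (induction p) simp_all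
  \<comment> \<open>\<open>ev\<close> has the image \<open>k(\<alpha>)[X]\<close>, which contains \<open>\<alpha>\<close> itself, the first approximation.\<close>
  have approx: "\<exists>P. [:- h c, 1:] ^ Suc n dvd Q - ev P" for n
  proof (induction n)
    case 0
    have "poly (Q - ev [:0, 1:]) (h c) = 0"
      by (simp add: ev_def \<alpha>_def)
    then have "[:- h c, 1:] ^ Suc 0 dvd Q - ev [:0, 1:]"
      by (simp only: poly_eq_0_iff_dvd power_Suc power_0 mult_1_right)
    then show ?case by blast
  next
    case (Suc n)
    then obtain P where P: "[:- h c, 1:] ^ Suc n dvd Q - ev P" by blast
    have "ev (P - map_poly (\<lambda>x. [:x:]) U * pcompose f P)
        = ev P - smult (inverse v) (poly (map_poly (map_poly h) f) (ev P))"
      using ev_const[of U] U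
      by (simp add: ev_def hp.map_poly_pcompose poly_pcompose)
    then show ?case
      using newton_step[OF root _ P] simple by (metis v_def zero_less_Suc)
  qed
  define t where "t = [:- c, 1:] ^ Suc (degree Q)"
  obtain P where P: "map_poly h t dvd Q - ev P"
  proof -
    have "map_poly h t = [:- h c, 1:] ^ Suc (degree Q)"
    proof -
      have "map_poly h (p ^ n) = map_poly h p ^ n" for p n
        by (induction n) simp_all
      moreover have "map_poly h [:- c, 1:] = [:- h c, 1:]"
        by (rule poly_eqI) (simp add: coeff_pCons split: nat.split)
      ultimately show ?thesis unfolding t_def by metis
    qed
    then show ?thesis using approx[of "degree Q"] that by metis
  qed
  \<comment> \<open>Reduction modulo \<open>t\<close> keeps the approximation and brings the degree below that of \<open>t\<close>.\<close>
  define P' where "P' = map_poly (\<lambda>p. p mod t) P"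
  have "map_poly h t dvd ev (P - P')"
  proof -
    have "P - P' = smult t (map_poly (\<lambda>p. p div t) P)"
      unfolding P'_def by (rule poly_eqI) (simp add: Polynomial.coeff_map_poly minus_mod_eq_mult_div)
    then show ?thesis by (simp add: ev_def)
  qed
  then have "map_poly h t dvd Q - ev P'"
    using P dvd_add[of "map_poly h t" "Q - ev P" "ev (P - P')"] by (simp add: ev_def)
  moreover have "degree (Q - ev P') < degree t"
  proof -
    have t: "degree t = Suc (degree Q)" unfolding t_def by (rule degree_linear_power)
    then have "t \<noteq> 0" by auto
    have "degree (poly.coeff P' i) < degree t" for i
      using degree_mod_less'[OF \<open>t \<noteq> 0\<close>] t by (cases "poly.coeff P i mod t = 0")
        (auto simp: P'_def Polynomial.coeff_map_poly)
    then have "degree (ev P') < degree t"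
      unfolding ev_def by (intro poly_degree_bound) simp
    then show ?thesis using t by (intro degree_diff_less) simp_all
  qed
  ultimately have "Q - ev P' = 0"
    using dvd_imp_degree_le[of "map_poly h t" "Q - ev P'"] by force
  then show ?thesis unfolding ev_def \<alpha>_def by auto
qed

section \<open>Degrees of generators of an extension\<close>

context
  fixes h :: "'a::field \<Rightarrow> 'b::field"
  assumes h: "domain_embedding h"
begin

interpretation domain_embedding h by (rule h)

interpretation vs: vector_space "\<lambda>a x. h a * x"
  by unfold_locales (simp_all add: algebra_simps)

lemma poly_mod_root:
  assumes "poly (map_poly h g) x = 0"
  shows "poly (map_poly h (A mod g)) x = poly (map_poly h A) x"
proof -
  have "map_poly h A = map_poly h (g * (A div g) + A mod g)" by simp
  also have "\<dots> = map_poly h g * map_poly h (A div g) + map_poly h (A mod g)"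
    by (simp only: map_poly_add map_poly_mult)
  finally show ?thesis using assms by simp
qed

lemma poly_in_span_powers:
  assumes "g \<noteq> 0" "poly (map_poly h g) x = 0"
  shows "poly (map_poly h A) x \<in> vs.span ((^) x ` {..<degree g})"
proof -
  define r where "r = A mod g"
  have eq: "poly (map_poly h A) x = poly (map_poly h r) x"
    using poly_mod_root[OF assms(2)] by (simp add: r_def)
  show ?thesis
  proof (cases "r = 0")
    case False
    then have "degree r < degree g"
      using degree_mod_less'[OF \<open>g \<noteq> 0\<close>] by (simp add: r_def)
    then have "(\<Sum>i\<le>degree r. h (poly.coeff r i) * x ^ i) \<in> vs.span ((^) x ` {..<degree g})"
      by (intro vs.span_sum vs.span_scale vs.span_base) auto
    then show ?thesis unfolding eq by (simp add: poly_altdef)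
  qed (simp add: eq vs.span_zero)
qed

lemma powers_independent:
  assumes "\<And>A. poly (map_poly h A) x = 0 \<Longrightarrow> A \<noteq> 0 \<Longrightarrow> n \<le> degree A"
  shows "vs.independent ((^) x ` {..<n}) \<and> card ((^) x ` {..<n}) = n"
proof -
  have indep: "a i = 0" if "(\<Sum>j<n. h (a j) * x ^ j) = 0" "i < n" for a i
  proof -
    define A where "A = (\<Sum>j<n. Polynomial.monom (a j) j)"
    have coeff: "poly.coeff A j = (if j < n then a j else 0)" for j
      by (simp add: A_def coeff_sum when_def)
    have "poly (map_poly h A) x = (\<Sum>j<n. h (a j) * x ^ j)"
    proof -
      have "map_poly h A = (\<Sum>j<n. Polynomial.monom (h (a j)) j)"
        by (rule poly_eqI) (simp add: coeff coeff_sum)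
      then show ?thesis by (simp add: poly_sum poly_monom)
    qed
    moreover have "degree A < n" if "A \<noteq> 0"
      using coeff leading_coeff_neq_0[OF that] by presburger
    ultimately have "A = 0" using assms[of A] that by fastforce
    then show "a i = 0" using coeff[of i] \<open>i < n\<close> by simp
  qed
  have inj: "inj_on ((^) x) {..<n}"
  proof (rule inj_onI, rule ccontr)
    fix i j assume ij: "i \<in> {..<n}" "j \<in> {..<n}" "x ^ i = x ^ j" "i \<noteq> j"
    define a where "a = (\<lambda>l. if l = i then 1 else if l = j then - 1 else 0 :: 'a)"
    have "(\<Sum>l<n. h (a l) * x ^ l) = (\<Sum>l\<in>{i, j}. h (a l) * x ^ l)"
      using ij by (intro sum.mono_neutral_right) (auto simp: a_def)
    also have "\<dots> = 0" using ij by (simp add: a_def)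
    finally have "a i = 0" using indep ij by blast
    then show False by (simp add: a_def)
  qed
  have "vs.independent ((^) x ` {..<n})"
  proof (rule vs.independent_if_scalars_zero)
    fix u y assume "(\<Sum>y\<in>(^) x ` {..<n}. h (u y) * y) = 0" "y \<in> (^) x ` {..<n}"
    then show "u y = 0" using indep[of "\<lambda>j. u (x ^ j)"] by (auto simp: sum.reindex[OF inj])
  qed simp
  then show ?thesis by (simp add: card_image inj)
qed

text \<open>
  The \<open>n\<close> powers of \<open>y\<close> are independent and lie in the span of the powers of \<open>x\<close> below any degree in
  which \<open>x\<close> has an equation. This bounds such degrees below by \<open>n\<close>; for the degree \<open>n\<close> itself, the two
  spans have the same dimension, so they agree and \<open>x\<close> is a polynomial in \<open>y\<close>.
\<close>

lemma generator_exchange: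
  assumes min: "\<And>A. poly (map_poly h A) y = 0 \<Longrightarrow> A \<noteq> 0 \<Longrightarrow> n \<le> degree A"
    and g: "g \<noteq> 0" "poly (map_poly h g) x = 0" "degree g = n"
    and y: "y = poly (map_poly h P) x"
  shows "\<exists>R. x = poly (map_poly h R) y"
    and "poly (map_poly h A) x = 0 \<Longrightarrow> A \<noteq> 0 \<Longrightarrow> n \<le> degree A"
proof -
  let ?S = "(^) y ` {..<n}"
  have S: "vs.independent ?S" "card ?S = n" using powers_independent[OF min] by auto
  have "y ^ i = poly (map_poly h (P ^ i)) x" for i
    by (induction i) (simp_all add: y)
  then have S_sub: "?S \<subseteq> vs.span ((^) x ` {..<degree A})"
    if "A \<noteq> 0" "poly (map_poly h A) x = 0" for A
    using poly_in_span_powers[OF that] by auto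
  have card_le: "card ((^) x ` {..<m}) \<le> m" for m
    using card_image_le[of "{..<m}" "(^) x"] by simp
  show "n \<le> degree A" if "poly (map_poly h A) x = 0" "A \<noteq> 0"
    using vs.independent_span_bound[OF _ S(1) S_sub[OF that(2,1)]] S(2) card_le[of "degree A"] by simp
  have "x \<in> vs.span ?S"
  proof (rule ccontr)
    assume x: "x \<notin> vs.span ?S"
    have "vs.independent (insert x ?S)" using vs.independent_insertI[OF x S(1)] .
    moreover have "insert x ?S \<subseteq> vs.span ((^) x ` {..<n})"
      using S_sub[OF g(1,2)] poly_in_span_powers[OF g(1,2), of "[:0, 1:]"] g(3) by simp
    ultimately have "card (insert x ?S) \<le> card ((^) x ` {..<n})"
      using vs.independent_span_bound[of "(^) x ` {..<n}" "insert x ?S"] by simp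
    moreover have "x \<notin> ?S" by (rule contra_subsetD[OF vs.span_superset x])
    ultimately show False using card_le[of n] S(2) by simp
  qed
  moreover have "vs.span ?S \<subseteq> {poly (map_poly h R) y | R. True}"
  proof (rule vs.span_minimal)
    have "y ^ i = poly (map_poly h (Polynomial.monom 1 i)) y" for i
      by (simp add: map_poly_monom poly_monom)
    then show "?S \<subseteq> {poly (map_poly h R) y | R. True}" by blast
    show "vs.subspace {poly (map_poly h R) y | R. True}"
    proof (rule vs.subspaceI, goal_cases)
      case 1
      have "0 = poly (map_poly h 0) y" by simp
      then show ?case by blast
    next
      case (2 u v)
      then show ?case by clarify (metis map_poly_add poly_add)
    next
      case (3 c u)
      then show ?case by clarify (metis map_poly_smult poly_smult)
    qed
  qed
  ultimately show "\<exists>R. x = poly (map_poly h R) y" by blast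
qed

end

section \<open>Roots in integrally closed and algebraically closed domains\<close>

text \<open>
  The ring of polynomials over a field is integrally closed: in a reduced fraction \<open>a / b\<close> that
  solves a monic equation, clearing denominators gives \<open>b dvd a ^ n\<close>.
\<close>

lemma monic_root_integral:
  fixes f :: "'a::{field_gcd} poly poly" and x :: "'a poly fract"
  assumes "Polynomial.lead_coeff f = 1" "poly (map_poly to_fract f) x = 0"
  shows "\<exists>q. x = to_fract q"
proof -
  obtain a b where ab: "quot_of_fract x = (a, b)" by (cases "quot_of_fract x")
  then have cop: "coprime a b" and x: "x = Fract a b" and b: "b \<noteq> 0"
    using quot_of_fract_in_normalized_fracts[of x] quot_to_fract_quot_of_fract[of x]
    by (auto simp: normalized_fracts_def quot_to_fract_def)
  define n where "n = degree f"
  have "0 = to_fract b ^ n * (\<Sum>i\<le>n. to_fract (poly.coeff f i) * x ^ i)"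
    using assms(2) by (simp add: poly_altdef Polynomial.coeff_map_poly Polynomial.degree_map_poly n_def)
  also have "\<dots> = (\<Sum>i\<le>n. to_fract (poly.coeff f i * a ^ i * b ^ (n - i)))"
  proof -
    have pow: "to_fract (p ^ i) = to_fract p ^ i" for p :: "'a poly" and i
      by (induction i) simp_all
    have "to_fract b ^ n * (to_fract (poly.coeff f i) * x ^ i)
        = to_fract (poly.coeff f i * a ^ i * b ^ (n - i))" if "i \<le> n" for i
    proof -
      have "to_fract b ^ n = to_fract b ^ i * to_fract b ^ (n - i)"
        using that by (simp add: power_add[symmetric])
      then show ?thesis
        using b by (simp add: x Fract_conv_to_fract power_divide pow)
    qed
    then show ?thesis unfolding sum_distrib_left by (intro sum.cong) auto
  qed
  also have "\<dots> = to_fract (\<Sum>i\<le>n. poly.coeff f i * a ^ i * b ^ (n - i))"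
    by simp
  finally have "(\<Sum>i\<le>n. poly.coeff f i * a ^ i * b ^ (n - i)) = 0"
    by (metis to_fract_eq_0_iff)
  then have sum: "(\<Sum>i<n. poly.coeff f i * a ^ i * b ^ (n - i)) + a ^ n = 0"
    using assms(1) by (simp add: n_def lessThan_Suc_atMost[symmetric])
  have "b dvd (\<Sum>i<n. poly.coeff f i * a ^ i * b ^ (n - i))"
    by (intro dvd_sum dvd_mult dvd_power) auto
  from dvd_add_right_iff[OF this, of "a ^ n"] have "b dvd a ^ n"
    unfolding sum by simp
  moreover have "coprime b (a ^ n)" using cop by (simp add: coprime_commute)
  ultimately have "is_unit b" using coprime_common_divisor[of b "a ^ n" b] by simp
  then obtain c where c: "b * c = 1" by (auto simp: dvd_def)
  then have "x = to_fract (a * c)"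
    using b c by (simp add: x to_fract_def eq_fract mult.assoc mult.commute[of c])
  then show ?thesis by blast
qed

text \<open>
  The polynomial splits into linear factors over \<open>'a\<close> already, and one of the images of these
  factors has to vanish at \<open>z\<close>.
\<close>

lemma root_in_alg_closed:
  fixes h :: "'a::alg_closed_field \<Rightarrow> 'b::idom"
  assumes "domain_embedding h" "p \<noteq> 0" "poly (map_poly h p) z = 0"
  shows "\<exists>r. z = h r"
  using assms(2,3)
proof (induction "degree p" arbitrary: p)
  interpret domain_embedding h by fact
  case 0
  then obtain a where "p = [:a:]" by (auto elim: degree_eq_zeroE)
  then show ?case using 0 by auto
next
  interpret domain_embedding h by fact
  case (Suc n)
  obtain r where "poly p r = 0" using alg_closed_imp_poly_has_root[of p] Suc(2) by auto
  then obtain q where q: "p = [:- r, 1:] * q" by (auto simp: poly_eq_0_iff_dvd elim: dvdE)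
  have "q \<noteq> 0" using Suc(3) q by auto
  have "degree q = n"
    using Suc(2,3) unfolding q by (subst (asm) degree_mult_eq) auto
  moreover have "z = h r \<or> poly (map_poly h q) z = 0"
    using Suc(4) unfolding q map_poly_mult by auto
  ultimately show ?case using Suc(1)[of q] \<open>q \<noteq> 0\<close> by auto
qed

section \<open>Residue classes modulo a polynomial over the rational functions\<close>

lemma type_ring_simps:
  "carrier ring_of_type_algebra = UNIV" "x \<otimes>\<^bsub>ring_of_type_algebra\<^esub> y = x * y"
  "x \<oplus>\<^bsub>ring_of_type_algebra\<^esub> y = x + y" "\<one>\<^bsub>ring_of_type_algebra\<^esub> = 1" "\<zero>\<^bsub>ring_of_type_algebra\<^esub> = 0"
  by (simp_all add: ring_of_type_algebra_def)

text \<open>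
  The coset of \<open>A\<close>, which turns computations in the quotient ring into congruences in the
  polynomial type.
\<close>

definition residue :: "'k::field poly poly \<Rightarrow> 'k poly fract poly \<Rightarrow> 'k poly fract poly set" where
  "residue G A = PIdl\<^bsub>rat_fun_poly_ring\<^esub> (over_rat_fun G) +>\<^bsub>rat_fun_poly_ring\<^esub> A"

lemma residue_eq: "residue G A = {x. over_rat_fun G dvd x - A}"
  unfolding residue_def a_r_coset_def' cgenideal_def rat_fun_poly_ring_def type_ring_simps
  by (auto simp: dvd_def algebra_simps)

lemma residue_eq_iff: "residue G A = residue G B \<longleftrightarrow> over_rat_fun G dvd A - B"
proof
  assume "residue G A = residue G B"
  moreover have "A \<in> residue G A" by (simp add: residue_eq)
  ultimately have "A \<in> residue G B" by simp
  then show "over_rat_fun G dvd A - B" by (simp add: residue_eq)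
next
  assume *: "over_rat_fun G dvd A - B"
  have "over_rat_fun G dvd x - A \<longleftrightarrow> over_rat_fun G dvd x - B" for x
    using dvd_add_left_iff[OF *, of "x - A"] by simp
  then show "residue G A = residue G B" by (simp add: residue_eq)
qed

lemma ext_emb_conv_residue: "ext_emb G c = residue G [:c:]"
  by (simp add: ext_emb_def residue_def)

lemma ideal_over_rat_fun: "ideal (PIdl\<^bsub>rat_fun_poly_ring\<^esub> (over_rat_fun G)) rat_fun_poly_ring"
  using cring.cgenideal_ideal[OF cring_from_type_algebra]
  by (simp add: rat_fun_poly_ring_def type_ring_simps)

lemma residue_hom: "residue G \<in> ring_hom ring_of_type_algebra (ext_ring G)"
  using ideal.rcos_ring_hom[OF ideal_over_rat_fun, of G]
  by (simp add: residue_def[abs_def] ext_ring_def rat_fun_poly_ring_def)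

lemma residue_add: "residue G A \<oplus>\<^bsub>ext_ring G\<^esub> residue G B = residue G (A + B)"
  using ring_hom_add[OF residue_hom, of A B G] by (simp add: type_ring_simps)

lemma residue_mult: "residue G A \<otimes>\<^bsub>ext_ring G\<^esub> residue G B = residue G (A * B)"
  using ring_hom_mult[OF residue_hom, of A B G] by (simp add: type_ring_simps)

lemma residue_one: "\<one>\<^bsub>ext_ring G\<^esub> = residue G 1"
  using ring_hom_one[OF residue_hom, of G] by (simp add: type_ring_simps)

lemma carrier_ext_ring: "carrier (ext_ring G) = range (residue G)"
  by (auto simp: ext_ring_def FactRing_def A_RCOSETS_def' residue_def rat_fun_poly_ring_def type_ring_simps)

lemma residue_in_carrier [simp]: "residue G A \<in> carrier (ext_ring G)"
  by (simp add: carrier_ext_ring)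

lemma cring_ext_ring: "cring (ext_ring G)"
  unfolding ext_ring_def
  using ideal.quotient_is_cring[OF ideal_over_rat_fun] cring_from_type_algebra
  by (metis rat_fun_poly_ring_def)

lemma residue_zero: "\<zero>\<^bsub>ext_ring G\<^esub> = residue G 0"
proof -
  interpret cring "ext_ring G" by (rule cring_ext_ring)
  have "residue G 0 \<oplus>\<^bsub>ext_ring G\<^esub> residue G 0 = residue G 0" by (simp add: residue_add)
  then show ?thesis using add.r_cancel_one' by (metis residue_in_carrier)
qed

lemma residue_eq_zero_iff: "residue G A = \<zero>\<^bsub>ext_ring G\<^esub> \<longleftrightarrow> over_rat_fun G dvd A"
  by (simp add: residue_zero residue_eq_iff)

lemma residue_uminus: "\<ominus>\<^bsub>ext_ring G\<^esub> residue G A = residue G (- A)"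
proof -
  interpret cring "ext_ring G" by (rule cring_ext_ring)
  show ?thesis
    by (rule minus_equality) (simp_all add: residue_add residue_zero)
qed

lemma field_ext_ring:
  assumes "irreducible_over_rat_fun G"
  shows "field (ext_ring G)"
proof -
  have irr: "Factorial_Ring.irreducible (over_rat_fun G)"
    using assms by (simp add: irreducible_over_rat_fun_def)
  show ?thesis
  proof (rule cring.cring_fieldI2[OF cring_ext_ring])
    have "\<not> over_rat_fun G dvd 1" using irr by (simp add: Factorial_Ring.irreducible_def)
    then show "\<zero>\<^bsub>ext_ring G\<^esub> \<noteq> \<one>\<^bsub>ext_ring G\<^esub>"
      by (metis residue_eq_zero_iff residue_one)
  next
    fix a assume "a \<in> carrier (ext_ring G)" "a \<noteq> \<zero>\<^bsub>ext_ring G\<^esub>"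
    then obtain A where A: "a = residue G A" by (auto simp: carrier_ext_ring)
    then have "\<not> over_rat_fun G dvd A"
      using \<open>a \<noteq> _\<close> by (simp add: residue_eq_zero_iff)
    then obtain u v where uv: "u * over_rat_fun G + v * A = 1"
      using irreducible_bezout[OF irr] by blast
    then have "A * v - 1 = over_rat_fun G * (- u)" by (simp add: algebra_simps add_eq_0_iff)
    then have "a \<otimes>\<^bsub>ext_ring G\<^esub> residue G v = \<one>\<^bsub>ext_ring G\<^esub>"
      by (simp add: A residue_mult residue_one residue_eq_iff)
    then show "\<exists>b\<in>carrier (ext_ring G). a \<otimes>\<^bsub>ext_ring G\<^esub> b = \<one>\<^bsub>ext_ring G\<^esub>"
      using residue_in_carrier by blast
  qed
qed

lemma emb_hom:
  fixes j :: "'a::field \<Rightarrow> 'k::field poly fract"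
  assumes "domain_embedding j"
  shows "(\<lambda>c. ext_emb G (j c)) \<in> ring_hom ring_of_type_algebra (ext_ring G)"
proof -
  interpret domain_embedding j by fact
  show ?thesis
    by (rule ring_hom_memI)
      (simp_all add: ext_emb_conv_residue type_ring_simps residue_mult residue_add residue_one one_pCons mult.commute)
qed

lemma emb_subfield:
  fixes j :: "'a::field \<Rightarrow> 'k::field poly fract"
  assumes "domain_embedding j" "irreducible_over_rat_fun G"
  shows "subfield (range (\<lambda>c. ext_emb G (j c))) (ext_ring G)"
proof -
  interpret field "ext_ring G" by (rule field_ext_ring) fact
  have "ring_hom_ring ring_of_type_algebra (ext_ring G) (\<lambda>c. ext_emb G (j c))"
    by (intro ring_hom_ringI2 ring_from_type_algebra ring_axioms emb_hom assms)
  from ring_hom_ring.img_is_subfield(2)[OF this field.carrier_is_subfield[OF field_from_type_algebra]]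
  show ?thesis by (simp add: type_ring_simps)
qed

lemma eval_residue:
  fixes j :: "'a::field \<Rightarrow> 'k::field poly fract"
  assumes "domain_embedding j"
  shows "ring.eval (ext_ring G) (map (\<lambda>c. ext_emb G (j c)) (rev (coeffs p))) (residue G A)
      = residue G (pcompose (map_poly j p) A)"
proof -
  interpret domain_embedding j by fact
  interpret cring "ext_ring G" by (rule cring_ext_ring)
  show ?thesis
  proof (induction p)
    case 0
    then show ?case by (simp add: residue_zero)
  next
    case (pCons a p)
    let ?l = "map (\<lambda>c. ext_emb G (j c)) (rev (coeffs p))"
    have "coeffs (pCons a p) = a # coeffs p" using pCons(1) by (auto simp: cCons_def)
    then have "eval (map (\<lambda>c. ext_emb G (j c)) (rev (coeffs (pCons a p)))) (residue G A)
        = eval (?l @ [ext_emb G (j a)]) (residue G A)"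
      by simp
    also have "\<dots> = eval ?l (residue G A) \<otimes>\<^bsub>ext_ring G\<^esub> residue G A \<oplus>\<^bsub>ext_ring G\<^esub> ext_emb G (j a)"
      by (rule eval_append_aux) (auto simp: ext_emb_conv_residue)
    also have "\<dots> = residue G (pcompose (map_poly j (pCons a p)) A)"
      unfolding pCons.IH
      by (simp add: ext_emb_conv_residue residue_mult residue_add pcompose_pCons algebra_simps)
    finally show ?case .
  qed
qed

text \<open>
  Algebraicity over a subset of a ring is defined by coefficient lists, highest degree first. For
  a subfield that is the image of a field type, a list corresponds to a typed polynomial, and a zero
  value to divisibility by the modulus.
\<close>

lemma algebraic_residue_iff:
  fixes j :: "'a::field \<Rightarrow> 'k::field poly fract"
  assumes j: "domain_embedding j" and irr: "irreducible_over_rat_fun G"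
  shows "ring.algebraic (ext_ring G) (range (\<lambda>c. ext_emb G (j c))) (residue G A)
    \<longleftrightarrow> (\<exists>p. p \<noteq> 0 \<and> over_rat_fun G dvd pcompose (map_poly j p) A)"
proof -
  interpret domain_embedding j by fact
  interpret field "ext_ring G" by (rule field_ext_ring) fact
  define \<phi> where "\<phi> = (\<lambda>c. ext_emb G (j c))"
  have sf: "subfield (range \<phi>) (ext_ring G)" unfolding \<phi>_def by (rule emb_subfield) fact+
  have \<phi>0: "\<phi> c = \<zero>\<^bsub>ext_ring G\<^esub> \<longleftrightarrow> c = 0" for c
  proof
    assume "\<phi> c = \<zero>\<^bsub>ext_ring G\<^esub>"
    then have "over_rat_fun G dvd [:j c:]"
      by (simp add: \<phi>_def ext_emb_conv_residue residue_eq_zero_iff)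
    moreover have "is_unit [:j c:]" if "c \<noteq> 0"
      using that by (simp add: is_unit_const_poly_iff dvd_field_iff)
    ultimately show "c = 0"
      using irr dvd_trans unfolding irreducible_over_rat_fun_def Factorial_Ring.irreducible_def by blast
  qed (simp add: \<phi>_def ext_emb_conv_residue residue_zero)
  show ?thesis unfolding \<phi>_def[symmetric]
  proof
    assume "ring.algebraic (ext_ring G) (range \<phi>) (residue G A)"
    then obtain l where l: "l \<in> carrier (univ_poly (ext_ring G) (range \<phi>))" "l \<noteq> []"
        "eval l (residue G A) = \<zero>\<^bsub>ext_ring G\<^esub>"
      using algebraicE[OF subfieldE(1)[OF sf]] by (metis over_def residue_in_carrier)
    then have "set l \<subseteq> range \<phi>" "hd l \<noteq> \<zero>\<^bsub>ext_ring G\<^esub>"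
      by (auto simp: univ_poly_carrier[symmetric] polynomial_def)
    define cs where "cs = map (inv_into UNIV \<phi>) l"
    have l_eq: "l = map \<phi> cs"
      using \<open>set l \<subseteq> range \<phi>\<close> by (auto simp: cs_def f_inv_into_f intro!: map_idI[symmetric])
    have "cs \<noteq> []" "hd cs \<noteq> 0"
      using \<open>l \<noteq> []\<close> \<open>hd l \<noteq> _\<close> by (auto simp: l_eq hd_map \<phi>0)
    then have coeffs: "coeffs (Poly (rev cs)) = rev cs"
      by (cases cs) auto
    then have "Poly (rev cs) \<noteq> 0"
      using \<open>cs \<noteq> []\<close> by (metis coeffs coeffs_0_eq_Nil rev_is_Nil_conv)
    moreover have "residue G (pcompose (map_poly j (Poly (rev cs))) A) = \<zero>\<^bsub>ext_ring G\<^esub>"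
      using l(3) eval_residue[OF j, of G "Poly (rev cs)" A]
      unfolding l_eq coeffs rev_rev_ident \<phi>_def by simp
    then have "over_rat_fun G dvd pcompose (map_poly j (Poly (rev cs))) A"
      by (simp only: residue_eq_zero_iff)
    ultimately show "\<exists>p. p \<noteq> 0 \<and> over_rat_fun G dvd pcompose (map_poly j p) A" by blast
  next
    assume "\<exists>p. p \<noteq> 0 \<and> over_rat_fun G dvd pcompose (map_poly j p) A"
    then obtain p where p: "p \<noteq> 0" "over_rat_fun G dvd pcompose (map_poly j p) A" by blast
    define l where "l = map \<phi> (rev (coeffs p))"
    have "hd l = \<phi> (Polynomial.lead_coeff p)" "l \<noteq> []"
      using p(1) by (simp_all add: l_def hd_map hd_rev last_coeffs_eq_coeff_degree)
    then have "l \<in> carrier (univ_poly (ext_ring G) (range \<phi>))"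
      using p(1) by (auto simp: univ_poly_carrier[symmetric] polynomial_def \<phi>0) (auto simp: l_def)
    then have "(algebraic over (range \<phi>)) (residue G A)"
      using \<open>l \<noteq> []\<close> eval_residue[OF j, of G p A] p(2)
      by (intro algebraicI[of l]) (simp_all add: l_def \<phi>_def residue_eq_zero_iff)
    then show "ring.algebraic (ext_ring G) (range \<phi>) (residue G A)" by (simp add: over_def)
  qed
qed

section \<open>A linear factor makes the extension constant\<close>

text \<open>
  The map \<open>A \<mapsto> A(R)\<close> on polynomials descends to the quotients: the first condition makes it well
  defined and injective, the second one surjective. It fixes the constants, hence is an isomorphism
  of extensions.
\<close>

lemma iso_of_substitution:
  assumes dvd: "\<And>A. over_rat_fun G dvd A \<longleftrightarrow> over_rat_fun H dvd pcompose A R"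
    and surj: "\<And>B. \<exists>A. over_rat_fun H dvd B - pcompose A R"
  shows "defined_by (ext_ring H) (ext_emb H) G"
proof -
  define h where "h = (\<lambda>z. residue H (pcompose (SOME A. residue G A = z) R))"
  have h: "h (residue G A) = residue H (pcompose A R)" for A
  proof -
    have "residue G (SOME B. residue G B = residue G A) = residue G A"
      by (rule someI[of _ A]) simp
    then show ?thesis
      by (simp add: h_def residue_eq_iff dvd pcompose_diff)
  qed
  have "h \<in> ring_hom (ext_ring G) (ext_ring H)"
    by (rule ring_hom_memI)
      (auto simp: carrier_ext_ring h residue_mult residue_add residue_one pcompose_mult pcompose_add pcompose_1)
  moreover have "bij_betw h (carrier (ext_ring G)) (carrier (ext_ring H))"
  proof (rule bij_betwI')
    show "h x = h y \<longleftrightarrow> x = y" if "x \<in> carrier (ext_ring G)" "y \<in> carrier (ext_ring G)" for x y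
    proof -
      obtain A B where "x = residue G A" "y = residue G B" using \<open>x \<in> _\<close> \<open>y \<in> _\<close> by (auto simp: carrier_ext_ring)
      then show ?thesis by (simp add: h residue_eq_iff dvd pcompose_diff)
    qed
    show "h x \<in> carrier (ext_ring H)" for x by (simp add: h_def)
    show "\<exists>x\<in>carrier (ext_ring G). y = h x" if "y \<in> carrier (ext_ring H)" for y
    proof -
      obtain B where "y = residue H B" using \<open>y \<in> _\<close> by (auto simp: carrier_ext_ring)
      moreover obtain A where "over_rat_fun H dvd B - pcompose A R" using surj by blast
      ultimately have "y = h (residue G A)" by (simp add: h residue_eq_iff)
      then show ?thesis using residue_in_carrier by blast
    qed
  qed
  ultimately have "h \<in> ring_iso (ext_ring G) (ext_ring H)" by (simp add: ring_iso_def)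
  moreover have "h (ext_emb G c) = ext_emb H c" for c
    by (simp add: ext_emb_conv_residue h)
  ultimately show ?thesis unfolding defined_by_def by blast
qed

lemma degree_X1_eq_0_iff:
  "degree_X1 G = 0 \<longleftrightarrow> (\<exists>g. G = map_poly (\<lambda>a. [:a:]) g)" for G :: "'a::field poly poly"
proof
  assume deg: "degree_X1 G = 0"
  define S where "S = {m | l m. bicoeff G (l, m) \<noteq> 0}"
  have "S \<subseteq> (\<Union>l\<le>degree G. {..degree (poly.coeff G l)})"
  proof
    fix m assume "m \<in> S"
    then obtain l where *: "poly.coeff (poly.coeff G l) m \<noteq> 0" by (auto simp: S_def bicoeff_def)
    then have "poly.coeff G l \<noteq> 0" by auto
    then show "m \<in> (\<Union>l\<le>degree G. {..degree (poly.coeff G l)})"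
      using * by (auto intro: le_degree)
  qed
  then have "finite S" by (rule finite_subset) simp
  have zero: "poly.coeff (poly.coeff G l) m = 0" if "m > 0" for l m
  proof (rule ccontr)
    assume "poly.coeff (poly.coeff G l) m \<noteq> 0"
    then have "m \<in> insert 0 S" by (auto simp: S_def bicoeff_def)
    then have "m \<le> Max (insert 0 S)" using \<open>finite S\<close> by simp
    then show False using deg that by (simp add: degree_X1_def S_def)
  qed
  have "G = map_poly (\<lambda>a. [:a:]) (map_poly (\<lambda>p. poly.coeff p 0) G)"
    by (rule poly_eqI, rule poly_eqI)
      (simp add: Polynomial.coeff_map_poly coeff_pCons zero split: nat.split)
  then show "\<exists>g. G = map_poly (\<lambda>a. [:a:]) g" by blast
next
  assume "\<exists>g. G = map_poly (\<lambda>a. [:a:]) g"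
  then obtain g where "G = map_poly (\<lambda>a. [:a:]) g" by blast
  then have "bicoeff G (l, m) = 0" if "m > 0" for l m
    using that by (cases m) (simp_all add: bicoeff_def Polynomial.coeff_map_poly)
  then have "insert 0 {m | l m. bicoeff G (l, m) \<noteq> 0} = {0}" by auto
  then show "degree_X1 G = 0" unfolding degree_X1_def by (simp only: Max_singleton)
qed

definition fract_to_ac :: "'k::field poly fract \<Rightarrow> 'k alg_closure poly fract" where
  "fract_to_ac = map_fract (map_poly to_ac)"

lemma fract_to_ac_embedding: "domain_embedding fract_to_ac"
  unfolding fract_to_ac_def
  by (intro domain_embedding.map_fract_embedding domain_embedding.map_poly_embedding to_ac_embedding)

lemma fract_to_ac_to_fract [simp]: "fract_to_ac (to_fract p) = to_fract (map_poly to_ac p)"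
  unfolding fract_to_ac_def
  by (rule domain_embedding.map_fract_to_fract)
    (intro domain_embedding.map_poly_embedding to_ac_embedding)

lemma map_poly_over_rat_fun:
  "map_poly fract_to_ac (over_rat_fun A) = map_poly to_fract (map_poly (map_poly to_ac) A)"
  by (rule poly_eqI) (simp add: over_rat_fun_def Polynomial.coeff_map_poly domain_embedding.zero[OF fract_to_ac_embedding])

lemma degree_over_rat_fun [simp]: "degree (over_rat_fun A) = degree A"
  unfolding over_rat_fun_def by (rule domain_embedding.degree_map_poly[OF to_fract_embedding])

lemma degree_pos_if_irreducible:
  assumes "irreducible_over_rat_fun H"
  shows "degree H > 0"
proof (rule ccontr)
  assume "\<not> degree H > 0"
  then have "degree (over_rat_fun H) = 0" by simp
  then obtain a where "over_rat_fun H = [:a:]" by (rule degree_eq_zeroE)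
  then show False using assms
    by (auto simp: irreducible_over_rat_fun_def Factorial_Ring.irreducible_def is_unit_const_poly_iff dvd_field_iff)
qed

lemma dvd_iff_root:
  assumes "irreducible_over_rat_fun H" "domain_embedding h"
    "poly (map_poly h (over_rat_fun H)) x = 0"
  shows "poly (map_poly h A) x = 0 \<longleftrightarrow> over_rat_fun H dvd A"
  using root_iff_irreducible_dvd assms unfolding irreducible_over_rat_fun_def by blast

text \<open>
  In characteristic zero the derivative in \<open>Y\<close> is nonzero and of smaller degree, so the irreducible
  \<open>H\<close> does not divide it.
\<close>

lemma root_separable:
  fixes H :: "'k::field_char_0 poly poly"
  assumes irr: "irreducible_over_rat_fun H"
    and root: "poly (map_poly (map_poly to_ac) H) Q = 0"
  shows "poly (pderiv (map_poly (map_poly to_ac) H)) Q \<noteq> 0"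
proof
  interpret tf: domain_embedding "to_fract :: 'k alg_closure poly \<Rightarrow> _" by (rule to_fract_embedding)
  interpret hp: domain_embedding "map_poly to_ac :: 'k poly \<Rightarrow> _"
    by (rule domain_embedding.map_poly_embedding[OF to_ac_embedding])
  assume "poly (pderiv (map_poly (map_poly to_ac) H)) Q = 0"
  then have "poly (map_poly fract_to_ac (over_rat_fun (pderiv H))) (to_fract Q) = 0"
    by (simp add: map_poly_over_rat_fun hp.map_poly_pderiv)
  moreover have "poly (map_poly fract_to_ac (over_rat_fun H)) (to_fract Q) = 0"
    using root by (simp add: map_poly_over_rat_fun)
  ultimately have "over_rat_fun H dvd over_rat_fun (pderiv H)"
    using dvd_iff_root[OF irr fract_to_ac_embedding] by blast
  moreover have "pderiv H \<noteq> 0" using degree_pos_if_irreducible[OF irr] by (simp add: pderiv_eq_0_iff)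
  then have "over_rat_fun (pderiv H) \<noteq> 0"
    by (simp add: over_rat_fun_def map_poly_eq_0_iff)
  ultimately have "degree H \<le> degree (pderiv H)"
    using dvd_imp_degree_le[of "over_rat_fun H" "over_rat_fun (pderiv H)"] by simp
  then show False using degree_pos_if_irreducible[OF irr] by (simp add: degree_pderiv)
qed

lemma exists_nat_nonroot: "p \<noteq> 0 \<Longrightarrow> \<exists>n::nat. poly p (of_nat n) \<noteq> 0" for p :: "'a::field_char_0 poly"
proof (rule ccontr)
  assume "p \<noteq> 0" "\<nexists>n::nat. poly p (of_nat n) \<noteq> 0"
  then have "range of_nat \<subseteq> {x. poly p x = 0}" by auto
  moreover have "infinite (range (of_nat :: nat \<Rightarrow> 'a))"
    by (rule range_inj_infinite) (rule inj_of_nat)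
  ultimately show False using poly_roots_finite[OF \<open>p \<noteq> 0\<close>] finite_subset by blast
qed

text \<open>
  Let \<open>Q\<close> be a root of \<open>H\<close> that is a polynomial over the algebraic closure. Choose a point \<open>c\<close> at
  which \<open>Q\<close> stays a simple root and let \<open>\<alpha> = Q(c)\<close>, a root of the specialization \<open>g(Y) = H(Y, c)\<close>.
  Then \<open>Q\<close> lies in \<open>k(\<alpha>)[X]\<close>. Since \<open>Q\<close> has degree \<open>deg H = deg g\<close> over the rational function field,
  comparing dimensions shows that \<open>\<alpha>\<close> and \<open>Q\<close> generate the same extension and that \<open>g\<close> is the minimal
  polynomial of \<open>\<alpha>\<close>. So \<open>g\<close>, which does not involve \<open>X\<close>, defines the same extension as \<open>H\<close>.
\<close>

lemma linear_factor_imp_defined_by_const: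
  fixes H :: "'k::field_char_0 poly poly"
  assumes irr: "irreducible_over_rat_fun H" and monic: "monic_in_Y H"
    and "has_linear_factor_Y H"
  shows "\<exists>G. degree_X1 G = 0 \<and> defined_by (ext_ring H) (ext_emb H) G"
proof -
  interpret ac: domain_embedding "to_ac :: 'k \<Rightarrow> _" by (rule to_ac_embedding)
  interpret hp: domain_embedding "map_poly to_ac :: 'k poly \<Rightarrow> _" by (rule ac.map_poly_embedding)
  interpret tf: domain_embedding "to_fract :: 'k alg_closure poly \<Rightarrow> _" by (rule to_fract_embedding)
  interpret \<iota>: domain_embedding "fract_to_ac :: 'k poly fract \<Rightarrow> _" by (rule fract_to_ac_embedding)
  obtain Q H' where "map_poly (map_poly to_ac) H = [:- Q, 1:] * H'"
    using assms(3) unfolding has_linear_factor_Y_def by blast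
  then have root: "poly (map_poly (map_poly to_ac) H) Q = 0" by simp
  define n where "n = degree H"
  define q where "q = to_fract Q"
  \<comment> \<open>A nonzero polynomial has only finitely many roots, so some natural number is a good point.\<close>
  obtain m where m: "poly (poly (pderiv (map_poly (map_poly to_ac) H)) Q) (of_nat m) \<noteq> 0"
    using exists_nat_nonroot root_separable[OF irr root] by blast
  define c where "c = (of_nat m :: 'k)"
  define \<alpha> where "\<alpha> = poly Q (to_ac c)"
  have "\<exists>p. p \<noteq> 0 \<and> poly (map_poly to_ac p) x = 0" for x :: "'k alg_closure"
    using alg_closure_algebraic by metis
  from root_in_simple_extension[OF to_ac_embedding this root, of c]
  obtain P where P: "Q = poly (map_poly (map_poly to_ac) P) [:\<alpha>:]"
    using m by (auto simp: c_def \<alpha>_def)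
  define g where "g = map_poly (\<lambda>p. poly p c) H"
  define G where "G = map_poly (\<lambda>a. [:a:]) g"
  have "poly.coeff g n = 1"
    using monic by (simp add: g_def Polynomial.coeff_map_poly n_def monic_in_Y_def)
  moreover have "degree g \<le> n" unfolding g_def n_def by (rule map_poly_degree_leq)
  ultimately have "degree g = n" by (metis le_antisym le_degree zero_neq_one)
  then have deg_G: "degree G = n"
    unfolding G_def by (simp add: domain_embedding.degree_map_poly[OF const_embedding])
  have "poly (map_poly to_ac g) \<alpha> = poly (poly (map_poly (map_poly to_ac) H) Q) (to_ac c)"
  proof -
    have "map_poly (\<lambda>p. poly p (to_ac c)) (map_poly (map_poly to_ac) H) = map_poly to_ac g"
      by (rule poly_eqI) (simp add: Polynomial.coeff_map_poly g_def)
    then show ?thesis by (simp add: poly_poly_eval[of _ Q] \<alpha>_def)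
  qed
  then have g\<alpha>: "poly (map_poly to_ac g) \<alpha> = 0" using root by simp
  have "poly (map_poly (map_poly to_ac) G) [:\<alpha>:] = [:poly (map_poly to_ac g) \<alpha>:]"
  proof -
    interpret const: domain_embedding "\<lambda>x::'k alg_closure. [:x:]" by (rule const_embedding)
    have "map_poly (map_poly to_ac) G = map_poly (\<lambda>x. [:x:]) (map_poly to_ac g)"
      by (rule poly_eqI) (simp add: G_def Polynomial.coeff_map_poly)
    then show ?thesis by simp
  qed
  then have G\<alpha>: "poly (map_poly fract_to_ac (over_rat_fun G)) (to_fract [:\<alpha>:]) = 0"
    using g\<alpha> by (simp add: map_poly_over_rat_fun)
  have Hq: "poly (map_poly fract_to_ac (over_rat_fun H)) q = 0"
    using root by (simp add: map_poly_over_rat_fun q_def)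
  have qP: "q = poly (map_poly fract_to_ac (over_rat_fun P)) (to_fract [:\<alpha>:])"
    using P by (simp add: map_poly_over_rat_fun q_def)
  have ker_q: "poly (map_poly fract_to_ac A) q = 0 \<longleftrightarrow> over_rat_fun H dvd A" for A
    using dvd_iff_root[OF irr fract_to_ac_embedding Hq] .
  have min_q: "n \<le> degree A" if "poly (map_poly fract_to_ac A) q = 0" "A \<noteq> 0" for A
    using dvd_imp_degree_le[of "over_rat_fun H" A] that by (simp add: ker_q n_def)
  have "G \<noteq> 0" using deg_G degree_pos_if_irreducible[OF irr] by (auto simp: n_def)
  then have "over_rat_fun G \<noteq> 0" by (simp add: over_rat_fun_def map_poly_eq_0_iff)
  note exch = generator_exchange[OF fract_to_ac_embedding min_q this G\<alpha> _ qP]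
  obtain R where R: "to_fract [:\<alpha>:] = poly (map_poly fract_to_ac R) q"
    using exch(1) deg_G by auto
  \<comment> \<open>\<open>\<alpha>\<close> has no equation of degree below \<open>n = deg G\<close>, so \<open>G\<close> is its minimal polynomial.\<close>
  have ker_\<alpha>: "poly (map_poly fract_to_ac A) (to_fract [:\<alpha>:]) = 0 \<longleftrightarrow> over_rat_fun G dvd A" for A
  proof
    assume "poly (map_poly fract_to_ac A) (to_fract [:\<alpha>:]) = 0"
    then have "poly (map_poly fract_to_ac (A mod over_rat_fun G)) (to_fract [:\<alpha>:]) = 0"
      by (simp add: poly_mod_root[OF fract_to_ac_embedding G\<alpha>])
    then have "A mod over_rat_fun G = 0 \<or> n \<le> degree (A mod over_rat_fun G)"
      using exch(2) deg_G by auto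
    then have "A mod over_rat_fun G = 0"
      using degree_mod_less'[OF \<open>over_rat_fun G \<noteq> 0\<close>, of A] deg_G by fastforce
    then show "over_rat_fun G dvd A" by auto
  qed (use G\<alpha> in \<open>auto elim!: dvdE\<close>)
  have "defined_by (ext_ring H) (ext_emb H) G"
  proof (rule iso_of_substitution)
    show "over_rat_fun G dvd A \<longleftrightarrow> over_rat_fun H dvd pcompose A R" for A
      by (simp add: ker_q[symmetric] ker_\<alpha>[symmetric] \<iota>.map_poly_pcompose poly_pcompose R)
    show "\<exists>A. over_rat_fun H dvd B - pcompose A R" for B
      \<comment> \<open>\<open>P\<close> writes \<open>Q\<close> in terms of \<open>\<alpha>\<close> and \<open>R\<close> writes \<open>\<alpha>\<close> in terms of \<open>Q\<close>.\<close>
    proof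
      show "over_rat_fun H dvd B - pcompose (pcompose B (over_rat_fun P)) R"
        unfolding ker_q[symmetric] using R qP
        by (simp add: \<iota>.map_poly_pcompose poly_pcompose)
    qed
  qed
  moreover have "degree_X1 G = 0" unfolding degree_X1_eq_0_iff G_def by blast
  ultimately show ?thesis by blast
qed

section \<open>Extensions generated by algebraic elements\<close>

definition const_fract :: "'k::field \<Rightarrow> 'k poly fract" where
  "const_fract c = to_fract [:c:]"

lemma const_fract_embedding: "domain_embedding const_fract"
  unfolding const_fract_def[abs_def] by (rule comp_embedding[OF to_fract_embedding const_embedding])

lemma residue_in_ext_algebraic_iff:
  assumes "irreducible_over_rat_fun G"
  shows "residue G A \<in> ext_algebraic G
    \<longleftrightarrow> (\<exists>p. p \<noteq> 0 \<and> over_rat_fun G dvd pcompose (map_poly const_fract p) A)"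
  using algebraic_residue_iff[OF const_fract_embedding assms, of A]
  by (simp add: ext_algebraic_def ext_consts_def const_fract_def)

text \<open>
  The constants are roots of linear polynomials over \<open>k\<close>, hence algebraic; together with \<open>X\<close> they
  generate the polynomials in \<open>X\<close> and then their quotients.
\<close>

lemma ext_emb_in_ext_algebraic_X1:
  assumes irr: "irreducible_over_rat_fun G"
  shows "ext_emb G a \<in> ext_algebraic_X1 G"
proof -
  interpret field "ext_ring G" by (rule field_ext_ring) fact
  interpret j: domain_embedding "const_fract :: 'a \<Rightarrow> _" by (rule const_fract_embedding)
  have const: "residue G [:const_fract c:] \<in> ext_algebraic_X1 G" for c
  proof -
    have "pcompose (map_poly const_fract [:- c, 1:]) [:const_fract c:] = 0"
      by (simp add: pcompose_pCons)
    then have "residue G [:const_fract c:] \<in> ext_algebraic G"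
      unfolding residue_in_ext_algebraic_iff[OF irr]
      by (intro exI[of _ "[:- c, 1:]"]) simp
    then show ?thesis unfolding ext_algebraic_X1_def by (blast intro: generate_field.incl)
  qed
  have X1: "residue G [:to_fract [:0, 1:]:] \<in> ext_algebraic_X1 G"
    unfolding ext_algebraic_X1_def
    by (rule generate_field.incl) (simp add: ext_X1_def ext_emb_conv_residue)
  have poly: "residue G [:to_fract p:] \<in> ext_algebraic_X1 G" for p
  proof (induction p)
    case 0
    show ?case using const[of 0] by (simp add: const_fract_def)
  next
    case (pCons c p)
    have "pCons c p = [:c:] + [:0, 1:] * p" by simp
    then have "to_fract (pCons c p) = const_fract c + to_fract [:0, 1:] * to_fract p"
      unfolding const_fract_def by (metis to_fract_add to_fract_mult)
    then have "residue G [:to_fract (pCons c p):] = residue G [:const_fract c:] \<oplus>\<^bsub>ext_ring G\<^esub>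
        (residue G [:to_fract [:0, 1:]:] \<otimes>\<^bsub>ext_ring G\<^esub> residue G [:to_fract p:])"
      by (simp add: residue_add residue_mult mult.commute)
    then show ?case
      using const[of c] X1 pCons.IH unfolding ext_algebraic_X1_def
      by (simp add: generate_field.eng_add generate_field.eng_mult)
  qed
  obtain p q where a: "a = Fract p q" "q \<noteq> 0" by (cases a)
  have inverse: "residue G [:to_fract q:] \<otimes>\<^bsub>ext_ring G\<^esub> residue G [:inverse (to_fract q):] = \<one>\<^bsub>ext_ring G\<^esub>"
    using a(2) by (simp add: residue_mult residue_one one_pCons)
  then have "inv\<^bsub>ext_ring G\<^esub> residue G [:to_fract q:] = residue G [:inverse (to_fract q):]"
    by (intro comm_inv_char) simp_all
  moreover have "residue G [:to_fract q:] \<noteq> \<zero>\<^bsub>ext_ring G\<^esub>"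
    using inverse by (metis l_null residue_in_carrier zero_not_one)
  ultimately have "residue G [:inverse (to_fract q):] \<in> ext_algebraic_X1 G"
    using poly[of q] generate_field.m_inv unfolding ext_algebraic_X1_def by metis
  then have "residue G [:to_fract p:] \<otimes>\<^bsub>ext_ring G\<^esub> residue G [:inverse (to_fract q):] \<in> ext_algebraic_X1 G"
    using poly[of p] unfolding ext_algebraic_X1_def by (rule generate_field.eng_mult[rotated])
  moreover have "residue G [:to_fract p:] \<otimes>\<^bsub>ext_ring G\<^esub> residue G [:inverse (to_fract q):] = ext_emb G a"
    by (simp add: residue_mult ext_emb_conv_residue a Fract_conv_to_fract divide_inverse mult.commute)
  ultimately show ?thesis by simp
qed

lemma ext_algebraic_X1_subset:
  assumes "irreducible_over_rat_fun G"
  shows "ext_algebraic_X1 G \<subseteq> carrier (ext_ring G)"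
proof -
  interpret field "ext_ring G" by (rule field_ext_ring) fact
  show ?thesis unfolding ext_algebraic_X1_def
    by (rule generate_field_incl) (auto simp: ext_X1_def ext_emb_conv_residue ext_algebraic_def)
qed

text \<open>
  If \<open>G\<close> has coefficients in \<open>k\<close>, the class of \<open>Y\<close> modulo \<open>G\<close> is algebraic over \<open>k\<close>; it generates the
  extension over \<open>k(X)\<close>, and an isomorphism of extensions preserves both properties.
\<close>

lemma defined_by_const_imp_generated:
  assumes irr: "irreducible_over_rat_fun H"
    and deg: "degree_X1 G = 0" and "defined_by (ext_ring H) (ext_emb H) G"
  shows "carrier (ext_ring H) \<subseteq> ext_algebraic_X1 H"
proof -
  interpret H: field "ext_ring H" by (rule field_ext_ring) fact
  obtain g where "G = map_poly (\<lambda>a. [:a:]) g" using deg degree_X1_eq_0_iff by blast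
  then have g: "over_rat_fun G = map_poly const_fract g"
    by (simp add: over_rat_fun_def const_fract_def[abs_def] map_poly_map_poly comp_def)
  obtain h where h: "h \<in> ring_iso (ext_ring G) (ext_ring H)" and emb: "\<And>c. h (ext_emb G c) = ext_emb H c"
    using assms(3) unfolding defined_by_def by blast
  have hom: "h \<in> ring_hom (ext_ring G) (ext_ring H)"
    and bij: "bij_betw h (carrier (ext_ring G)) (carrier (ext_ring H))"
    using h by (auto simp: ring_iso_def)
  have "h (residue G [:0, 1:]) \<in> carrier (ext_ring H)"
    using hom by (rule ring_hom_closed) simp
  then obtain R where R: "h (residue G [:0, 1:]) = residue H R" by (auto simp: carrier_ext_ring)
  have h_residue: "h (residue G A) = residue H (pcompose A R)" for A
  proof (induction A)
    case 0
    have "h \<zero>\<^bsub>ext_ring G\<^esub> = \<zero>\<^bsub>ext_ring H\<^esub>"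
      using ring_hom_zero[OF hom cring.axioms(1)[OF cring_ext_ring] cring.axioms(1)[OF cring_ext_ring]] .
    then show ?case by (simp add: residue_zero)
  next
    case (pCons a A)
    have "residue G (pCons a A) = ext_emb G a \<oplus>\<^bsub>ext_ring G\<^esub> residue G [:0, 1:] \<otimes>\<^bsub>ext_ring G\<^esub> residue G A"
      by (simp add: ext_emb_conv_residue residue_mult residue_add)
    moreover have "h (ext_emb G a \<oplus>\<^bsub>ext_ring G\<^esub> residue G [:0, 1:] \<otimes>\<^bsub>ext_ring G\<^esub> residue G A)
        = h (ext_emb G a) \<oplus>\<^bsub>ext_ring H\<^esub> h (residue G [:0, 1:]) \<otimes>\<^bsub>ext_ring H\<^esub> h (residue G A)"
    proof -
      have "residue G [:0, 1:] \<otimes>\<^bsub>ext_ring G\<^esub> residue G A \<in> carrier (ext_ring G)"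
        by (simp add: residue_mult)
      then show ?thesis
        by (simp add: ring_hom_add[OF hom] ring_hom_mult[OF hom] ext_emb_conv_residue)
    qed
    ultimately show ?case
      using emb[of a] by (simp add: R pCons.IH ext_emb_conv_residue residue_mult residue_add pcompose_pCons)
  qed
  \<comment> \<open>If \<open>G\<close> were zero, \<open>Y\<close> would be invertible in the polynomial ring.\<close>
  have "g \<noteq> 0"
  proof
    assume "g = 0"
    then have G: "over_rat_fun G dvd A \<longleftrightarrow> A = 0" for A by (simp add: g)
    have h0: "h (residue G A) = \<zero>\<^bsub>ext_ring H\<^esub> \<longleftrightarrow> A = 0" for A
    proof -
      have "h (residue G A) = h (residue G 0) \<longleftrightarrow> residue G A = residue G 0"
        by (rule inj_on_eq_iff[OF bij_betw_imp_inj_on[OF bij]]) simp_all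
      then show ?thesis by (simp add: h_residue residue_zero residue_eq_iff G)
    qed
    then have "h (residue G [:0, 1:]) \<noteq> \<zero>\<^bsub>ext_ring H\<^esub>" by simp
    then obtain b where "b \<in> carrier (ext_ring H)" "h (residue G [:0, 1:]) \<otimes>\<^bsub>ext_ring H\<^esub> b = \<one>\<^bsub>ext_ring H\<^esub>"
      using H.field_Units R by (metis Diff_iff H.Units_r_inv H.Units_inv_closed empty_iff insert_iff residue_in_carrier)
    moreover obtain B where "b = h (residue G B)"
      using \<open>b \<in> _\<close> bij_betw_imp_surj_on[OF bij] unfolding carrier_ext_ring by blast
    ultimately have "residue H (pcompose ([:0, 1:] * B - 1) R) = \<zero>\<^bsub>ext_ring H\<^esub>"
      by (simp only: h_residue residue_mult residue_one residue_eq_zero_iff residue_eq_iff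
          pcompose_diff pcompose_mult pcompose_1)
    then have "[:0, 1:] * B - 1 = 0" using h0 by (simp add: h_residue)
    then have "poly ([:0, 1:] * B) 0 = 1" by (metis eq_iff_diff_eq_0 poly_1)
    then show False by simp
  qed
  moreover have "over_rat_fun H dvd pcompose (map_poly const_fract g) R"
  proof -
    have "residue G (over_rat_fun G) = residue G 0" by (simp add: residue_eq_iff)
    then have "residue H (pcompose (over_rat_fun G) R) = residue H (pcompose 0 R)"
      using h_residue by metis
    then show ?thesis by (simp add: residue_eq_iff g)
  qed
  ultimately have "residue H R \<in> ext_algebraic H"
    unfolding residue_in_ext_algebraic_iff[OF irr] by blast
  then have R_in: "residue H R \<in> ext_algebraic_X1 H"
    unfolding ext_algebraic_X1_def by (blast intro: generate_field.incl)
  have "residue H (pcompose A R) \<in> ext_algebraic_X1 H" for A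
  proof (induction A)
    case 0
    then show ?case using ext_emb_in_ext_algebraic_X1[OF irr, of 0] by (simp add: ext_emb_conv_residue)
  next
    case (pCons a A)
    have "residue H (pcompose (pCons a A) R)
        = ext_emb H a \<oplus>\<^bsub>ext_ring H\<^esub> residue H R \<otimes>\<^bsub>ext_ring H\<^esub> residue H (pcompose A R)"
      by (simp add: ext_emb_conv_residue residue_mult residue_add pcompose_pCons)
    then show ?case
      using ext_emb_in_ext_algebraic_X1[OF irr, of a] R_in pCons.IH
      unfolding ext_algebraic_X1_def
      by (simp add: generate_field.eng_add generate_field.eng_mult)
  qed
  moreover have "carrier (ext_ring H) = range (\<lambda>A. residue H (pcompose A R))"
    using bij_betw_imp_surj_on[OF bij] by (simp add: carrier_ext_ring image_image h_residue)
  ultimately show ?thesis by auto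
qed

text \<open>
  This supplies reduced fractions for the function field over the algebraic closure.
\<close>

instance alg_closure :: (field) field_gcd ..

text \<open>
  Adjoin a root \<open>\<theta>\<close> of \<open>H\<close> in an algebraic closure \<open>\<Omega>\<close> of the rational function field over the
  algebraic closure of \<open>k\<close>; sending \<open>Y\<close> to \<open>\<theta>\<close> embeds the extension into \<open>\<Omega>\<close>. Elements algebraic over
  \<open>k\<close> can only go to constants, because the algebraic closure of \<open>k\<close> is algebraically closed, and so
  everything that they generate with \<open>X\<close> goes to the rational function field. If this is the whole
  extension, then \<open>\<theta>\<close> is a rational function; being a root of a monic polynomial, it is a polynomial.
  The field \<open>\<Omega>\<close> contains a copy of every algebraic extension at once, so no embeddings of the
  algebraic elements have to be extended step by step.
\<close>

lemma generated_imp_linear_factor: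
  fixes H :: "'k::field poly poly"
  assumes irr: "irreducible_over_rat_fun H" and monic: "monic_in_Y H"
    and gen: "carrier (ext_ring H) \<subseteq> ext_algebraic_X1 H"
  shows "has_linear_factor_Y H"
proof -
  interpret field "ext_ring H" by (rule field_ext_ring) fact
  interpret \<iota>: domain_embedding "fract_to_ac :: 'k poly fract \<Rightarrow> _" by (rule fract_to_ac_embedding)
  interpret e: domain_embedding "to_ac :: 'k alg_closure poly fract \<Rightarrow> _" by (rule to_ac_embedding)
  interpret tf: domain_embedding "to_fract :: 'k alg_closure poly \<Rightarrow> _" by (rule to_fract_embedding)
  define j where "j = (\<lambda>x :: 'k poly fract. to_ac (fract_to_ac x))"
  interpret j: domain_embedding j unfolding j_def
    by (rule comp_embedding[OF to_ac_embedding fract_to_ac_embedding])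
  have "degree (map_poly j (over_rat_fun H)) > 0" using degree_pos_if_irreducible[OF irr] by simp
  then obtain \<theta> where \<theta>: "poly (map_poly j (over_rat_fun H)) \<theta> = 0"
    using alg_closed_imp_poly_has_root by blast
  have ev_cong: "poly (map_poly j A) \<theta> = poly (map_poly j B) \<theta>" if "residue H A = residue H B" for A B
  proof -
    have "poly (map_poly j (A - B)) \<theta> = 0"
      using dvd_iff_root[OF irr j.domain_embedding_axioms \<theta>] that by (simp only: residue_eq_iff)
    then show ?thesis by simp
  qed
  define k where "k = (\<lambda>c :: 'k alg_closure. to_ac (to_fract [:c:]))"
  have k: "domain_embedding k" unfolding k_def
    by (intro comp_embedding[OF to_ac_embedding] comp_embedding[OF to_fract_embedding] const_embedding)
  have descend: "\<exists>A z. x = residue H A \<and> poly (map_poly j A) \<theta> = to_ac z" if "x \<in> ext_algebraic_X1 H" for x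
    using that unfolding ext_algebraic_X1_def
  proof (induction rule: generate_field.induct)
    case one
    have "poly (map_poly j 1) \<theta> = to_ac 1" by simp
    then show ?case using residue_one by blast
  next
    case (incl x)
    then consider "x = ext_X1 H" | "x \<in> ext_algebraic H" by blast
    then show ?case
    proof cases
      case 1
      have "poly (map_poly j [:to_fract [:0, 1:]:]) \<theta> = to_ac (fract_to_ac (to_fract [:0, 1:]))"
        using j_def j.map_poly_pCons[of "to_fract [:0, 1:]" 0] by simp
      then show ?thesis using 1 unfolding ext_X1_def ext_emb_conv_residue by blast
    next
      case 2
      then obtain A where A: "x = residue H A" by (auto simp: ext_algebraic_def carrier_ext_ring)
      then obtain p where p: "p \<noteq> 0" "over_rat_fun H dvd pcompose (map_poly const_fract p) A"
        using 2 residue_in_ext_algebraic_iff[OF irr] by blast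
      have "map_poly j (map_poly const_fract p) = map_poly k (map_poly to_ac p)"
        by (rule poly_eqI)
          (simp add: Polynomial.coeff_map_poly j_def k_def const_fract_def
            domain_embedding.map_poly_pCons[OF to_ac_embedding])
      moreover have "poly (map_poly j (pcompose (map_poly const_fract p) A)) \<theta> = 0"
        using p(2) dvd_iff_root[OF irr j.domain_embedding_axioms \<theta>] by blast
      ultimately have "poly (map_poly k (map_poly to_ac p)) (poly (map_poly j A) \<theta>) = 0"
        by (simp add: j.map_poly_pcompose poly_pcompose)
      moreover have "map_poly to_ac p \<noteq> 0" using p(1) by (simp add: map_poly_eq_0_iff)
      ultimately obtain r where "poly (map_poly j A) \<theta> = k r"
        using root_in_alg_closed[OF k] by blast
      then show ?thesis using A unfolding k_def by blast
    qed
  next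
    case (a_inv x)
    then obtain A z where "x = residue H A" "poly (map_poly j A) \<theta> = to_ac z" by blast
    then have "\<ominus>\<^bsub>ext_ring H\<^esub> x = residue H (- A) \<and> poly (map_poly j (- A)) \<theta> = to_ac (- z)"
      by (simp add: residue_uminus)
    then show ?case by blast
  next
    case (m_inv x)
    then obtain A z where A: "x = residue H A" "poly (map_poly j A) \<theta> = to_ac z" by blast
    then have unit: "x \<in> Units (ext_ring H)" using m_inv(2) field_Units by simp
    then obtain B where B: "inv\<^bsub>ext_ring H\<^esub> x = residue H B"
      using Units_inv_closed by (auto simp: carrier_ext_ring)
    then have "residue H (A * B) = residue H 1"
      using Units_r_inv[OF unit] A by (simp add: residue_mult residue_one)
    from ev_cong[OF this] have "to_ac z * poly (map_poly j B) \<theta> = 1" using A by simp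
    then have "poly (map_poly j B) \<theta> = to_ac (inverse z)"
      by (simp add: inverse_unique)
    then show ?case using B by blast
  next
    case (eng_add x y)
    then obtain A z B w where "x = residue H A" "poly (map_poly j A) \<theta> = to_ac z"
      "y = residue H B" "poly (map_poly j B) \<theta> = to_ac w" by blast
    then have "x \<oplus>\<^bsub>ext_ring H\<^esub> y = residue H (A + B) \<and> poly (map_poly j (A + B)) \<theta> = to_ac (z + w)"
      by (simp add: residue_add)
    then show ?case by blast
  next
    case (eng_mult x y)
    then obtain A z B w where "x = residue H A" "poly (map_poly j A) \<theta> = to_ac z"
      "y = residue H B" "poly (map_poly j B) \<theta> = to_ac w" by blast
    then have "x \<otimes>\<^bsub>ext_ring H\<^esub> y = residue H (A * B) \<and> poly (map_poly j (A * B)) \<theta> = to_ac (z * w)"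
      by (simp add: residue_mult)
    then show ?case by blast
  qed
  have "residue H [:0, 1:] \<in> ext_algebraic_X1 H" using gen by auto
  from descend[OF this] obtain A z where "residue H [:0, 1:] = residue H A" "poly (map_poly j A) \<theta> = to_ac z"
    by blast
  then have "\<theta> = to_ac z" using ev_cong[of "[:0, 1:]" A] by simp
  have "map_poly j (over_rat_fun H) = map_poly to_ac (map_poly fract_to_ac (over_rat_fun H))"
    unfolding j_def by (rule map_poly_comp[OF to_ac_embedding fract_to_ac_embedding, symmetric])
  then have "to_ac (poly (map_poly fract_to_ac (over_rat_fun H)) z) = 0"
    using \<theta> \<open>\<theta> = to_ac z\<close> by simp
  then have z: "poly (map_poly to_fract (map_poly (map_poly to_ac) H)) z = 0"
    by (simp add: map_poly_over_rat_fun)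
  interpret ac: domain_embedding "map_poly to_ac :: 'k poly \<Rightarrow> _"
    by (rule domain_embedding.map_poly_embedding[OF to_ac_embedding])
  have "Polynomial.lead_coeff (map_poly (map_poly to_ac) H) = 1"
    using monic by (simp add: monic_in_Y_def)
  then obtain Q where "z = to_fract Q" using monic_root_integral[OF _ z] by blast
  then have "poly (map_poly (map_poly to_ac) H) Q = 0" using z by simp
  then have "[:- Q, 1:] dvd map_poly (map_poly to_ac) H" by (simp add: poly_eq_0_iff_dvd)
  then show ?thesis unfolding has_linear_factor_Y_def dvd_def by blast
qed

text \<open>
  The extension is simple, generated by the class of \<open>Y\<close>, which is a root of \<open>H\<close>.
\<close>

lemma finite_dimension_ext_ring:
  assumes irr: "irreducible_over_rat_fun H"
  shows "ring.finite_dimension (ext_ring H) (range (ext_emb H)) (carrier (ext_ring H))"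
proof -
  interpret field "ext_ring H" by (rule field_ext_ring) fact
  have id: "domain_embedding (\<lambda>x :: 'a poly fract. x)" by unfold_locales auto
  have sf: "subfield (range (ext_emb H)) (ext_ring H)"
    using emb_subfield[OF id irr] by simp
  have "over_rat_fun H \<noteq> 0" using degree_pos_if_irreducible[OF irr]
    by (metis degree_0 degree_over_rat_fun less_irrefl)
  then have "algebraic (range (ext_emb H)) (residue H [:0, 1:])"
    using algebraic_residue_iff[OF id irr, of "[:0, 1:]"]
    by (auto intro!: exI[of _ "over_rat_fun H"] simp: pcompose_idR)
  then have "finite_dimension (range (ext_emb H)) (simple_extension (range (ext_emb H)) (residue H [:0, 1:]))"
    using finite_dimension_simple_extension[OF sf] by (simp add: over_def)
  moreover have "simple_extension (range (ext_emb H)) (residue H [:0, 1:]) = carrier (ext_ring H)"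
  proof
    show "simple_extension (range (ext_emb H)) (residue H [:0, 1:]) \<subseteq> carrier (ext_ring H)"
      using simple_extension_incl[OF subfieldE(3)[OF sf]] sf subfieldE(3)
      by (simp add: simple_extension_in_carrier)
    have "residue H A \<in> simple_extension (range (ext_emb H)) (residue H [:0, 1:])" for A
    proof (induction A)
      case 0
      then show ?case using simple_extension.zero by (simp add: residue_zero)
    next
      case (pCons a A)
      have "residue H (pCons a A) = residue H A \<otimes>\<^bsub>ext_ring H\<^esub> residue H [:0, 1:] \<oplus>\<^bsub>ext_ring H\<^esub> ext_emb H a"
        by (simp add: ext_emb_conv_residue residue_mult residue_add)
      then show ?case using simple_extension.lin[OF pCons.IH] by simp
    qed
    then show "carrier (ext_ring H) \<subseteq> simple_extension (range (ext_emb H)) (residue H [:0, 1:])"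
      by (auto simp: carrier_ext_ring)
  qed
  ultimately show ?thesis by simp
qed

text \<open>
  The degree of the extension is finite, so only properness and the condition on the defining
  polynomials remain.
\<close>

lemma one_genuine_poly_iff:
  assumes irr: "irreducible_over_rat_fun H" and "monic_in_Y H"
  shows "one_genuine_poly H \<longleftrightarrow> range (ext_emb H) \<noteq> carrier (ext_ring H) \<and>
    (\<forall>G. defined_by (ext_ring H) (ext_emb H) G \<longrightarrow> degree_X1 G \<noteq> 0)"
proof -
  have id: "domain_embedding (\<lambda>x :: 'a poly fract. x)" by unfold_locales auto
  have "ext_emb H \<in> ring_hom ring_of_type_algebra (ext_ring H)"
    using emb_hom[OF id, of H] by simp
  then show ?thesis
    using assms field_ext_ring[OF irr] finite_dimension_ext_ring[OF irr]
    by (auto simp: one_genuine_poly_def one_genuine_extension_def finite_nontrivial_extension_def)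
qed

section \<open>The equivalence\<close>

theorem theorem6p6:
  fixes H :: "'k::field_char_0 poly poly" and D :: nat and B :: "int_mpoly set"
  assumes "number_field TYPE('k)"
    and "\<forall>l m. algebraic_int (bicoeff H (l, m))"
    and "irreducible_over_rat_fun H"
    and "monic_in_Y H"
    and "total_degree H = D"
    and "is_B_lin TYPE('k) D B"
  shows "(one_genuine_poly H \<longleftrightarrow> ext_algebraic_X1 H \<subset> carrier (ext_ring H)) \<and>
         (ext_algebraic_X1 H \<subset> carrier (ext_ring H) \<longleftrightarrow> \<not> has_linear_factor_Y H) \<and>
         (\<not> has_linear_factor_Y H \<longleftrightarrow> B_nonzero_at B (bicoeff H))"
proof -
  note irr = assms(3) and monic = assms(4)
  have proper: "ext_algebraic_X1 H \<subset> carrier (ext_ring H)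
      \<longleftrightarrow> \<not> carrier (ext_ring H) \<subseteq> ext_algebraic_X1 H"
    using ext_algebraic_X1_subset[OF irr] by blast
  have "range (ext_emb H) \<subseteq> ext_algebraic_X1 H"
    using ext_emb_in_ext_algebraic_X1[OF irr] by blast
  then have "carrier (ext_ring H) \<subseteq> ext_algebraic_X1 H" if "\<not> one_genuine_poly H"
    using that defined_by_const_imp_generated[OF irr] one_genuine_poly_iff[OF irr monic] by blast
  moreover have "\<not> one_genuine_poly H" if "has_linear_factor_Y H"
    using linear_factor_imp_defined_by_const[OF irr monic that] one_genuine_poly_iff[OF irr monic] by blast
  moreover have "\<not> has_linear_factor_Y H \<longleftrightarrow> B_nonzero_at B (bicoeff H)"
    using assms unfolding is_B_lin_def B_nonzero_at_def by auto
  ultimately show ?thesis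
    using proper generated_imp_linear_factor[OF irr monic] by blast
qed

end
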